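(* Let $(X_1,d_1)$ and $(X_2,d_2)$ be geodesic metric spaces, and let the geodesic metric space $X=X_1\times X_2$ be endowed with the isometric product metric $$d((x_1,x_2),(y_1,y_2))=\sqrt{d_1(x_1,y_1)^2+d_2(x_2,y_2)^2}.$$ Then for every $\delta>0$ the $\delta$-covers satisfy $$\tilde X^\delta=\tilde X_1^\delta\times\tilde X_2^\delta,$$ and thus $$\operatorname{CovSpec}(X)=\operatorname{CovSpec}(X_1)\cup\operatorname{CovSpec}(X_2).$$
   Context: **Geodesic metric space.** A metric space $(X,d)$ in which every pair of points $p,q$ is joined by a curve $\gamma$ whose rectifiable length equals the distance: $d(p,q)=\inf\{L(C):C(0)=p,\ C(1)=q\}=L(\gamma)$. **$\delta$-covers.** Let $Y$ be a (locally path connected) length space, $p\in Y$, and let $\mathcal U$ be an open covering of $Y$. Let $\pi_1(Y,\mathcal U,p)$ be the normal subgroup of $\pi_1(Y,p)$ generated by the homotopy classes of closed paths having a representative of the form $\alpha^{-1}\circ\beta\circ\alpha$, where $\beta$ is a closed path lying in some element of $\mathcal U$ and $\alpha$ is a path from $p$ to $\beta(0)$. By Spanier there is a covering space $\tilde Y_{\mathcal U}$ of $Y$ with covering group $\pi_1(Y,\mathcal U,p)$ (i.e. a closed path at $p$ lifts to a closed path exactly when its class lies in $\pi_1(Y,\mathcal U,p)$). For $\delta>0$ the $\delta$-cover $\tilde Y^\delta$ is $\tilde Y_{\mathcal U_\delta}$, where $\mathcal U_\delta$ is the open covering of $Y$ by all balls of radius $\delta$. It carries the length metric lifted from $Y$.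 **Equality of covers.** Equality of covers means equality (isomorphism) as covering spaces of the same base; $\tilde X_1^\delta\times\tilde X_2^\delta$ is regarded as a cover of $X$ via the product of the covering projections $\tilde X_i^\delta\to X_i$, and is endowed with the isometric product metric. **Covering spectrum.** For a length space $Y$ (the definition is given for complete length spaces), $\operatorname{CovSpec}(Y)$ is the set of all $\delta>0$ such that $\tilde Y^\delta\ne\tilde Y^{\delta'}$ for all $\delta'>\delta$. *)

theory Defs
  imports "HOL-Analysis.Analysis" "HOL-Algebra.Coset"
begin

section \<open>Geodesic metric spaces\<close>

text \<open>Rectifiable length of a curve parametrised by \<open>{0..1}\<close>: the supremum, over all
  subdivisions \<open>0 = t 0 \<le> \<dots> \<le> t n = 1\<close>, of the lengths of the inscribed polygons.\<close>

definition curve_length :: "(real \<Rightarrow> 'a::metric_space) \<Rightarrow> ennreal" where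
  "curve_length \<gamma> =
     (SUP (n, t) \<in> {(n :: nat, t :: nat \<Rightarrow> real). t 0 = 0 \<and> t n = 1 \<and> (\<forall>i<n. t i \<le> t (Suc i))}.
        \<Sum>i<n. ennreal (dist (\<gamma> (t i)) (\<gamma> (t (Suc i)))))"

definition geodesic_space :: "'a::metric_space itself \<Rightarrow> bool" where
  "geodesic_space (_ :: 'a itself) \<longleftrightarrow>
     (\<forall>p q :: 'a. \<exists>\<gamma>. path \<gamma> \<and> pathstart \<gamma> = p \<and> pathfinish \<gamma> = q \<and>
        ennreal (dist p q) =
          (INF C \<in> {C. path C \<and> pathstart C = p \<and> pathfinish C = q}. curve_length C) \<and>
        ennreal (dist p q) = curve_length \<gamma>)"

section \<open>The subgroup of the fundamental group determined by an open covering\<close>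

definition path_class :: "(real \<Rightarrow> 'a::topological_space) \<Rightarrow> (real \<Rightarrow> 'a) set" where
  "path_class \<gamma> = {\<gamma>'. homotopic_paths UNIV \<gamma> \<gamma>'}"

definition fundamental_group :: "'a::topological_space \<Rightarrow> (real \<Rightarrow> 'a) set monoid" where
  "fundamental_group p =
     \<lparr>carrier = {path_class \<gamma> | \<gamma>. path \<gamma> \<and> pathstart \<gamma> = p \<and> pathfinish \<gamma> = p},
      mult = (\<lambda>A B. {h. \<exists>f\<in>A. \<exists>g\<in>B. homotopic_paths UNIV (f +++ g) h}),
      one = path_class (\<lambda>_. p)\<rparr>"

text \<open>The group \<open>\<pi>\<^sub>1(Y, \<U>, p)\<close>. The operation \<open>+++\<close> runs through its left argument first.\<close>

definition covering_subgroup ::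
    "'a::topological_space set set \<Rightarrow> 'a \<Rightarrow> (real \<Rightarrow> 'a) set set" where
  "covering_subgroup \<U> p =
     \<Inter> {N. N \<lhd> fundamental_group p \<and>
            {path_class (\<alpha> +++ \<beta> +++ reversepath \<alpha>) | \<alpha> \<beta>.
               path \<alpha> \<and> pathstart \<alpha> = p \<and> path \<beta> \<and> pathstart \<beta> = pathfinish \<alpha> \<and>
               pathfinish \<beta> = pathstart \<beta> \<and> (\<exists>U\<in>\<U>. path_image \<beta> \<subseteq> U)} \<subseteq> N}"

section \<open>The covering space belonging to that subgroup\<close>

text \<open>Spanier's construction. The points over \<open>y\<close> are the classes of paths from \<open>p\<close> to \<open>y\<close>,
  where \<open>\<gamma>\<close> and \<open>\<gamma>'\<close> are identified iff the closed path \<open>\<gamma> +++ reversepath \<gamma>'\<close> represents an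
  element of \<open>\<pi>\<^sub>1(Y, \<U>, p)\<close>. The topology has as basis the sets of classes of the prolongations
  of a fixed path \<open>\<gamma>\<close> inside an open set \<open>V\<close>. The lift at the class of the constant path of a
  closed path \<open>\<gamma>\<close> at \<open>p\<close> ends in the class of \<open>\<gamma>\<close>, so it is closed iff \<open>\<gamma>\<close> represents an element
  of \<open>\<pi>\<^sub>1(Y, \<U>, p)\<close>.\<close>

definition cover_point ::
    "'a::topological_space set set \<Rightarrow> 'a \<Rightarrow> (real \<Rightarrow> 'a) \<Rightarrow> (real \<Rightarrow> 'a) set" where
  "cover_point \<U> p \<gamma> =
     {\<gamma>'. path \<gamma>' \<and> pathstart \<gamma>' = p \<and> pathfinish \<gamma>' = pathfinish \<gamma> \<and>
          path_class (\<gamma> +++ reversepath \<gamma>') \<in> covering_subgroup \<U> p}"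

definition cover_space ::
    "'a::topological_space set set \<Rightarrow> 'a \<Rightarrow> (real \<Rightarrow> 'a) set topology" where
  "cover_space \<U> p =
     topology_generated_by
       {{cover_point \<U> p (\<gamma> +++ \<eta>) | \<eta>. path \<eta> \<and> pathstart \<eta> = pathfinish \<gamma> \<and> path_image \<eta> \<subseteq> V}
         | \<gamma> V. path \<gamma> \<and> pathstart \<gamma> = p \<and> open V}"

definition cover_proj :: "(real \<Rightarrow> 'a::topological_space) set \<Rightarrow> 'a" where
  "cover_proj e = the_elem (pathfinish ` e)"

text \<open>The length metric lifted along \<open>\<pi>\<close>: a path upstairs has the length of its projection.\<close>

definition lifted_dist ::
    "'e topology \<Rightarrow> ('e \<Rightarrow> 'a::metric_space) \<Rightarrow> 'e \<Rightarrow> 'e \<Rightarrow> real" where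
  "lifted_dist E \<pi> e e' =
     enn2real (INF c \<in> {c. pathin E c \<and> c 0 = e \<and> c 1 = e'}. curve_length (\<pi> \<circ> c))"

definition cover_isomorphism ::
    "'e topology \<Rightarrow> ('e \<Rightarrow> 'a) \<Rightarrow> 'f topology \<Rightarrow> ('f \<Rightarrow> 'a) \<Rightarrow> ('e \<Rightarrow> 'f) \<Rightarrow> bool" where
  "cover_isomorphism E \<pi> E' \<pi>' f \<longleftrightarrow>
     homeomorphic_map E E' f \<and> (\<forall>e \<in> topspace E. \<pi>' (f e) = \<pi> e)"

section \<open>Delta-covers and the covering spectrum\<close>

definition delta_cover :: "'a::metric_space \<Rightarrow> real \<Rightarrow> (real \<Rightarrow> 'a) set topology" where
  "delta_cover p \<delta> = cover_space (range (\<lambda>y. ball y \<delta>)) p"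

definition delta_dist ::
    "'a::metric_space \<Rightarrow> real \<Rightarrow> (real \<Rightarrow> 'a) set \<Rightarrow> (real \<Rightarrow> 'a) set \<Rightarrow> real" where
  "delta_dist p \<delta> = lifted_dist (delta_cover p \<delta>) cover_proj"

text \<open>In a path connected space the isomorphism type of the cover does not depend on the base
  point \<open>p\<close>, so that the quantifier over \<open>p\<close> could equally be existential.\<close>

definition covering_spectrum :: "'a::metric_space itself \<Rightarrow> real set" where
  "covering_spectrum (_ :: 'a itself) =
     {\<delta>. \<delta> > 0 \<and>
         (\<forall>\<delta>'>\<delta>. \<forall>p :: 'a.
            \<not> (\<exists>f. cover_isomorphism (delta_cover p \<delta>) cover_proj (delta_cover p \<delta>') cover_proj f))}"

end

theory Submission
  imports Defs
begin

text \<open>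
  The theorem rests on one identity of subgroups. Call a loop null at scale \<open>\<delta>\<close> if its class lies in the
  normal subgroup generated by the loops \<open>\<alpha> +++ \<beta> +++ reversepath \<alpha>\<close> with \<open>\<beta>\<close> in a ball of radius \<open>\<delta>\<close>. A loop in the
  product is null iff both its components are (\<open>null_loop_prod\<close>): the projections do not increase
  distances and the inclusions of slices preserve them, so both send balls of radius \<open>\<delta>\<close> into such
  balls, and every loop of the product is, up to homotopy, the concatenation of its projections to two
  slices. As the points of a delta-cover are classes of paths modulo null loops, taking the components of a
  path is a bijection between the delta-cover of the product and the product of the delta-covers, and the
  description of the topologies by sheets of prolongations makes it a homeomorphism over the base
  (\<open>cover_isomorphism_delta_cover_split\<close>).

  For the metrics, a delta-cover of a geodesic space has sections over balls of radius \<open>\<delta>\<close>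
  (\<open>sections_over_balls_delta_cover\<close>), so that a curve upstairs can be replaced by a fine polygon of lifted
  geodesics with the same ends (\<open>reach_polygon\<close>). Hence the lifted distance is an infimum over curves
  with Lipschitz parametrisation. Two such curves in the factors, run through with constant speed in the same
  time, give the upper bound \<open>sqrt (L1\<^sup>2 + L2\<^sup>2)\<close> for the distance in the product, and Minkowski's inequality
  for the two projections of a fine polygon gives the lower bound (\<open>lifted_dist_prod\<close>).

  For the spectra, unique lifting and normality show that the covers at two scales are isomorphic iff the same
  loops are null at both scales (\<open>delta_covers_isomorphic_iff\<close>). By \<open>null_loop_prod\<close> this holds for the
  product iff it holds for both factors. That the loops null at scale \<open>\<delta>\<close> increase with \<open>\<delta>\<close> permits
  passing to the smaller of two scales, which yields the union of the spectra
  (\<open>covering_spectrum_prod\<close>).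
\<close>

section \<open>Homotopies of paths\<close>

abbreviation loop_at :: "'a::topological_space \<Rightarrow> (real \<Rightarrow> 'a) \<Rightarrow> bool" where
  "loop_at p \<gamma> \<equiv> path \<gamma> \<and> pathstart \<gamma> = p \<and> pathfinish \<gamma> = p"

lemma constant_path [simp]:
  "path (\<lambda>_. x)" "pathstart (\<lambda>_. x) = x" "pathfinish (\<lambda>_. x) = x"
  by (simp_all add: path_def pathstart_def pathfinish_def)

text \<open>The unit and inverse laws, and the division of a path at a point, compare reparametrisations of one
  path \<open>\<gamma>\<close>, and in the convex interval any two parametrisations with the same ends are homotopic. Composing with \<open>\<gamma>\<close>
  transports these homotopies to an arbitrary topological space, which need not have line segments.\<close>

lemma homotopic_paths_pullback_interval:
  fixes \<gamma> :: "real \<Rightarrow> 'a::topological_space" and a b :: "real \<Rightarrow> real"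
  assumes "path \<gamma>" "path a" "path b" "path_image a \<subseteq> {0..1}" "path_image b \<subseteq> {0..1}"
    and "pathstart a = pathstart b" "pathfinish a = pathfinish b"
  shows "homotopic_paths UNIV (\<gamma> \<circ> a) (\<gamma> \<circ> b)"
proof (rule homotopic_paths_continuous_image)
  show "homotopic_paths {0..1} a b"
  proof (rule homotopic_paths_linear)
    fix t :: real assume "t \<in> {0..1}"
    then have "a t \<in> {0..1}" "b t \<in> {0..1}"
      using assms unfolding path_image_def by blast+
    then show "closed_segment (a t) (b t) \<subseteq> {0..1}"
      by (simp add: closed_segment_subset)
  qed (use assms in auto)
  show "continuous_on {0..1} \<gamma>" using assms by (simp add: path_def)
qed auto

lemma homotopic_paths_const_right:
  fixes \<gamma> :: "real \<Rightarrow> 'a::topological_space"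
  assumes "path \<gamma>" "x = pathfinish \<gamma>"
  shows "homotopic_paths UNIV (\<gamma> +++ (\<lambda>_. x)) \<gamma>"
proof -
  have "homotopic_paths UNIV (\<gamma> \<circ> (linepath 0 1 +++ linepath 1 1)) (\<gamma> \<circ> linepath 0 1)"
    using assms by (intro homotopic_paths_pullback_interval)
      (auto simp: path_image_join closed_segment_eq_real_ivl)
  moreover have "\<gamma> \<circ> linepath 0 1 = \<gamma>" "\<gamma> \<circ> linepath 1 1 = (\<lambda>_. x)"
    using assms by (auto simp: linepath_def pathfinish_def)
  ultimately show ?thesis by (simp add: path_compose_join)
qed

lemma homotopic_paths_const_left:
  fixes \<gamma> :: "real \<Rightarrow> 'a::topological_space"
  assumes "path \<gamma>" "x = pathstart \<gamma>"
  shows "homotopic_paths UNIV ((\<lambda>_. x) +++ \<gamma>) \<gamma>"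
proof -
  have "homotopic_paths UNIV (\<gamma> \<circ> (linepath 0 0 +++ linepath 0 1)) (\<gamma> \<circ> linepath 0 1)"
    using assms by (intro homotopic_paths_pullback_interval)
      (auto simp: path_image_join closed_segment_eq_real_ivl)
  moreover have "\<gamma> \<circ> linepath 0 1 = \<gamma>" "\<gamma> \<circ> linepath 0 0 = (\<lambda>_. x)"
    using assms by (auto simp: linepath_def pathstart_def)
  ultimately show ?thesis by (simp add: path_compose_join)
qed

lemma homotopic_paths_inverse_right:
  fixes \<gamma> :: "real \<Rightarrow> 'a::topological_space"
  assumes "path \<gamma>"
  shows "homotopic_paths UNIV (\<gamma> +++ reversepath \<gamma>) (\<lambda>_. pathstart \<gamma>)"
proof -
  have "homotopic_paths UNIV (\<gamma> \<circ> (linepath 0 1 +++ linepath 1 0)) (\<gamma> \<circ> linepath 0 0)"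
    using assms by (intro homotopic_paths_pullback_interval)
      (auto simp: path_image_join closed_segment_eq_real_ivl)
  moreover have "\<gamma> \<circ> linepath 0 1 = \<gamma>" "\<gamma> \<circ> linepath 1 0 = reversepath \<gamma>"
      "\<gamma> \<circ> linepath 0 0 = (\<lambda>_. pathstart \<gamma>)"
    by (auto simp: linepath_def pathstart_def reversepath_def)
  ultimately show ?thesis by (simp add: path_compose_join)
qed

lemma path_compose_linepath:
  fixes \<gamma> :: "real \<Rightarrow> 'a::topological_space"
  assumes "path \<gamma>" "u \<in> {0..1}" "v \<in> {0..1}"
  shows "path (\<gamma> \<circ> linepath u v)"
proof -
  have "closed_segment u v \<subseteq> {0..1}"
    using assms by (simp add: closed_segment_subset)
  then show ?thesis
    using assms(1) by (intro path_continuous_image) (auto simp: path_def intro: continuous_on_subset)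
qed

lemma homotopic_paths_segment_join:
  fixes \<gamma> :: "real \<Rightarrow> 'a::topological_space"
  assumes "path \<gamma>" "u \<in> {0..1}" "v \<in> {0..1}" "w \<in> {0..1}"
  shows "homotopic_paths UNIV ((\<gamma> \<circ> linepath u v) +++ (\<gamma> \<circ> linepath v w)) (\<gamma> \<circ> linepath u w)"
proof -
  have c: "closed_segment u v \<subseteq> {0..1}" if "u \<in> {0..1}" "v \<in> {0..1}" for u v :: real
    using that by (simp add: closed_segment_subset)
  show ?thesis
    unfolding path_compose_join[symmetric]
    using assms c[of u v] c[of v w] c[of u w]
    by (intro homotopic_paths_pullback_interval) (auto simp: path_image_join)
qed

lemma homotopic_paths_assoc_UNIV:
  assumes "path f" "path g" "path h" "pathfinish f = pathstart g" "pathfinish g = pathstart h"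
  shows "homotopic_paths UNIV (f +++ (g +++ h)) ((f +++ g) +++ h)"
  using assms by (intro homotopic_paths_assoc) auto

text \<open>The shape of word that occurs when the relation ``\<open>a\<close> followed by the reverse of \<open>b\<close> is small'' is
  composed with itself or compared after a common prolongation.\<close>

lemma homotopic_paths_cancel_middle:
  fixes a b c :: "real \<Rightarrow> 'a::topological_space"
  assumes "path a" "path b" "path c" "pathfinish b = pathfinish a" "pathstart c = pathfinish b"
    and "x = pathstart b"
  shows "homotopic_paths UNIV ((a +++ reversepath b) +++ (b +++ c)) (a +++ c)"
proof -
  have i: "homotopic_paths UNIV (reversepath b +++ b) (\<lambda>_. pathfinish b)"
    using homotopic_paths_inverse_right[of "reversepath b"] assms by simp
  have "homotopic_paths UNIV ((a +++ reversepath b) +++ (b +++ c)) (a +++ (reversepath b +++ (b +++ c)))"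
    by (rule homotopic_paths_sym, rule homotopic_paths_assoc_UNIV) (use assms in auto)
  also have "homotopic_paths UNIV \<dots> (a +++ ((reversepath b +++ b) +++ c))"
    by (intro homotopic_paths_join homotopic_paths_assoc_UNIV) (use assms in auto)
  also have "homotopic_paths UNIV \<dots> (a +++ ((\<lambda>_. pathfinish b) +++ c))"
    by (intro homotopic_paths_join i) (use assms in auto)
  also have "homotopic_paths UNIV \<dots> (a +++ c)"
    by (intro homotopic_paths_join homotopic_paths_const_left) (use assms in auto)
  finally show ?thesis .
qed

lemma homotopic_paths_Pair:
  fixes a a' :: "real \<Rightarrow> 'a::topological_space" and b b' :: "real \<Rightarrow> 'b::topological_space"
  assumes "homotopic_paths UNIV a a'" "homotopic_paths UNIV b b'"
  shows "homotopic_paths UNIV (\<lambda>t. (a t, b t)) (\<lambda>t. (a' t, b' t))"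
proof -
  obtain h where h: "continuous_on ({0..1} \<times> {0..1}) h" "\<forall>x\<in>{0..1}. h (0,x) = a x"
    "\<forall>x\<in>{0..1}. h (1,x) = a' x"
    "\<forall>t\<in>{0..1::real}. pathstart(h \<circ> Pair t) = pathstart a \<and> pathfinish(h \<circ> Pair t) = pathfinish a"
    using assms(1) unfolding homotopic_paths by blast
  obtain k where k: "continuous_on ({0..1} \<times> {0..1}) k" "\<forall>x\<in>{0..1}. k (0,x) = b x"
    "\<forall>x\<in>{0..1}. k (1,x) = b' x"
    "\<forall>t\<in>{0..1::real}. pathstart(k \<circ> Pair t) = pathstart b \<and> pathfinish(k \<circ> Pair t) = pathfinish b"
    using assms(2) unfolding homotopic_paths by blast
  show ?thesis unfolding homotopic_paths
    by (rule exI[of _ "\<lambda>z. (h z, k z)"])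
      (use h k in \<open>auto simp: pathstart_def pathfinish_def intro: continuous_on_Pair\<close>)
qed

section \<open>The fundamental group and its covering subgroup\<close>

lemma path_class_eq_iff:
  assumes "path \<gamma>"
  shows "path_class \<gamma> = path_class \<gamma>' \<longleftrightarrow> homotopic_paths UNIV \<gamma> \<gamma>'"
proof
  assume "path_class \<gamma> = path_class \<gamma>'"
  moreover have "\<gamma> \<in> path_class \<gamma>" using assms by (simp add: path_class_def)
  ultimately show "homotopic_paths UNIV \<gamma> \<gamma>'"
    by (simp add: path_class_def homotopic_paths_sym)
next
  assume "homotopic_paths UNIV \<gamma> \<gamma>'"
  then show "path_class \<gamma> = path_class \<gamma>'"
    unfolding path_class_def using homotopic_paths_sym homotopic_paths_trans by blast
qed

lemma path_class_eqI: "homotopic_paths UNIV \<gamma> \<gamma>' \<Longrightarrow> path_class \<gamma> = path_class \<gamma>'"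
  using path_class_eq_iff homotopic_paths_imp_path by blast

text \<open>The product of two classes is defined as the set of all paths homotopic to a concatenation of
  representatives; transitivity of homotopy reduces it to one choice of representatives.\<close>

lemma fundamental_group_mult:
  assumes "loop_at p f" "loop_at p g"
  shows "path_class f \<otimes>\<^bsub>fundamental_group p\<^esub> path_class g = path_class (f +++ g)"
proof -
  have "homotopic_paths UNIV (f +++ g) h" 
    if "homotopic_paths UNIV f f'" "homotopic_paths UNIV g g'" "homotopic_paths UNIV (f' +++ g') h" for f' g' h
    using homotopic_paths_trans[OF homotopic_paths_join[OF that(1,2)] that(3)] assms by simp
  then show ?thesis
    using assms unfolding fundamental_group_def path_class_def by force
qed

lemma fundamental_group_carrier:
  "A \<in> carrier (fundamental_group p) \<longleftrightarrow> (\<exists>f. loop_at p f \<and> A = path_class f)"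
  by (auto simp: fundamental_group_def)

lemma fundamental_group_one: "\<one>\<^bsub>fundamental_group p\<^esub> = path_class (\<lambda>_. p)"
  by (simp add: fundamental_group_def)

lemma group_fundamental_group: "group (fundamental_group p)" (is "group ?G")
proof (rule groupI)
  fix A B assume "A \<in> carrier ?G" "B \<in> carrier ?G"
  then obtain f g where "loop_at p f" "loop_at p g" "A = path_class f" "B = path_class g"
    unfolding fundamental_group_carrier by blast
  moreover have "loop_at p (f +++ g)" using calculation by simp
  ultimately show "A \<otimes>\<^bsub>?G\<^esub> B \<in> carrier ?G"
    using fundamental_group_mult fundamental_group_carrier by metis
next
  show "\<one>\<^bsub>?G\<^esub> \<in> carrier ?G"
    unfolding fundamental_group_one fundamental_group_carrier by (intro exI[of _ "\<lambda>_. p"]) simp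
next
  fix A B C assume "A \<in> carrier ?G" "B \<in> carrier ?G" "C \<in> carrier ?G"
  then obtain f g h where *: "loop_at p f" "loop_at p g" "loop_at p h"
    "A = path_class f" "B = path_class g" "C = path_class h"
    unfolding fundamental_group_carrier by blast
  moreover have "loop_at p (f +++ g)" "loop_at p (g +++ h)" using * by auto
  moreover have "path_class ((f +++ g) +++ h) = path_class (f +++ (g +++ h))"
    by (rule path_class_eqI, rule homotopic_paths_sym, rule homotopic_paths_assoc_UNIV) (use *(1-3) in auto)
  ultimately show "A \<otimes>\<^bsub>?G\<^esub> B \<otimes>\<^bsub>?G\<^esub> C = A \<otimes>\<^bsub>?G\<^esub> (B \<otimes>\<^bsub>?G\<^esub> C)"
    by (simp add: fundamental_group_mult)
next
  fix A assume "A \<in> carrier ?G"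
  then obtain f where f: "loop_at p f" "A = path_class f"
    unfolding fundamental_group_carrier by blast
  have "path_class ((\<lambda>_. p) +++ f) = path_class f"
    by (rule path_class_eqI, rule homotopic_paths_const_left) (use f in auto)
  then show "\<one>\<^bsub>?G\<^esub> \<otimes>\<^bsub>?G\<^esub> A = A"
    unfolding fundamental_group_one f(2) using f(1) by (subst fundamental_group_mult) auto
  have "homotopic_paths UNIV (reversepath f +++ f) (\<lambda>_. p)"
    using homotopic_paths_inverse_right[of "reversepath f"] f by simp
  from path_class_eqI[OF this] have "path_class (reversepath f) \<otimes>\<^bsub>?G\<^esub> A = \<one>\<^bsub>?G\<^esub>"
    unfolding fundamental_group_one f(2) using f(1)
    by (subst fundamental_group_mult) simp_all
  moreover have "path_class (reversepath f) \<in> carrier ?G"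
    unfolding fundamental_group_carrier using f by (intro exI[of _ "reversepath f"]) auto
  ultimately show "\<exists>B\<in>carrier ?G. B \<otimes>\<^bsub>?G\<^esub> A = \<one>\<^bsub>?G\<^esub>" by blast
qed

lemma fundamental_group_inv:
  assumes "loop_at p f"
  shows "inv\<^bsub>fundamental_group p\<^esub> (path_class f) = path_class (reversepath f)"
proof (rule group.inv_equality[OF group_fundamental_group])
  have "homotopic_paths UNIV (reversepath f +++ f) (\<lambda>_. p)"
    using homotopic_paths_inverse_right[of "reversepath f"] assms by simp
  from path_class_eqI[OF this]
  show "path_class (reversepath f) \<otimes>\<^bsub>fundamental_group p\<^esub> path_class f = \<one>\<^bsub>fundamental_group p\<^esub>"
    unfolding fundamental_group_one using assms
    by (subst fundamental_group_mult) simp_all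
qed (use assms in \<open>auto simp: fundamental_group_carrier intro: exI[of _ "reversepath f"]\<close>)

text \<open>The whole group is a normal subgroup containing the generators, so that the intersection in the
  definition is taken over a nonempty family.\<close>

lemma covering_subgroup_normal: "covering_subgroup \<U> p \<lhd> fundamental_group p" (is "?K \<lhd> ?G")
proof -
  interpret G: group ?G by (rule group_fundamental_group)
  let ?S = "{path_class (\<alpha> +++ \<beta> +++ reversepath \<alpha>) | \<alpha> \<beta>.
               path \<alpha> \<and> pathstart \<alpha> = p \<and> path \<beta> \<and> pathstart \<beta> = pathfinish \<alpha> \<and>
               pathfinish \<beta> = pathstart \<beta> \<and> (\<exists>U\<in>\<U>. path_image \<beta> \<subseteq> U)}"
  let ?A = "{N. N \<lhd> ?G \<and> ?S \<subseteq> N}"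
  have K: "?K = \<Inter> ?A" unfolding covering_subgroup_def ..
  have "carrier ?G \<lhd> ?G"
    by (rule G.normal_invI) (auto simp: G.subgroup_self)
  moreover have "?S \<subseteq> carrier ?G"
  proof
    fix A assume "A \<in> ?S"
    then obtain \<alpha> \<beta> where "A = path_class (\<alpha> +++ \<beta> +++ reversepath \<alpha>)"
      "path \<alpha>" "pathstart \<alpha> = p" "path \<beta>" "pathstart \<beta> = pathfinish \<alpha>"
      "pathfinish \<beta> = pathstart \<beta>" by blast
    then show "A \<in> carrier ?G"
      unfolding fundamental_group_carrier
      by (intro exI[of _ "\<alpha> +++ \<beta> +++ reversepath \<alpha>"]) simp
  qed
  ultimately have ne: "?A \<noteq> {}" by blast
  show ?thesis unfolding K
  proof (rule G.normal_invI)
    show "subgroup (\<Inter>?A) ?G"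
      by (rule G.subgroups_Inter) (use ne in \<open>auto dest: normal_imp_subgroup\<close>)
    show "x \<otimes>\<^bsub>?G\<^esub> h \<otimes>\<^bsub>?G\<^esub> inv\<^bsub>?G\<^esub> x \<in> \<Inter>?A" if "x \<in> carrier ?G" "h \<in> \<Inter>?A" for x h
      using that by (auto intro: normal.inv_op_closed2)
  qed
qed

text \<open>A loop is null if it lifts to a closed path in the covering space. Working with loops instead of
  their classes keeps the group-theoretic arguments at the level of path algebra.\<close>

definition null_loop :: "'a::topological_space set set \<Rightarrow> 'a \<Rightarrow> (real \<Rightarrow> 'a) \<Rightarrow> bool" where
  "null_loop \<U> p \<gamma> \<longleftrightarrow> path_class \<gamma> \<in> covering_subgroup \<U> p"

lemma null_loop_homotopic:
  assumes "homotopic_paths UNIV \<gamma> \<gamma>'"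
  shows "null_loop \<U> p \<gamma> \<longleftrightarrow> null_loop \<U> p \<gamma>'"
  unfolding null_loop_def using path_class_eqI[OF assms] by simp

lemma null_loop_imp_loop:
  assumes "null_loop \<U> p \<gamma>"
  shows "loop_at p \<gamma>"
proof -
  have "path_class \<gamma> \<in> carrier (fundamental_group p)"
    using assms normal_imp_subgroup[OF covering_subgroup_normal] subgroup.subset
    unfolding null_loop_def by blast
  then obtain f where "loop_at p f" "path_class f = path_class \<gamma>"
    unfolding fundamental_group_carrier by metis
  then show ?thesis
    using path_class_eq_iff homotopic_paths_imp_path homotopic_paths_imp_pathstart
      homotopic_paths_imp_pathfinish by metis
qed

lemma null_loop_join: "null_loop \<U> p f \<Longrightarrow> null_loop \<U> p g \<Longrightarrow> null_loop \<U> p (f +++ g)"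
  using null_loop_imp_loop[of \<U> p] fundamental_group_mult[of f p g]
    subgroup.m_closed[OF normal_imp_subgroup[OF covering_subgroup_normal[of \<U> p]]]
  unfolding null_loop_def by metis

lemma null_loop_reverse: "null_loop \<U> p f \<Longrightarrow> null_loop \<U> p (reversepath f)"
  using null_loop_imp_loop[of \<U> p f] fundamental_group_inv[of f p]
    subgroup.m_inv_closed[OF normal_imp_subgroup[OF covering_subgroup_normal[of \<U> p]]]
  unfolding null_loop_def by metis

lemma null_loop_const: "null_loop \<U> p (\<lambda>_. p)"
  using subgroup.one_closed[OF normal_imp_subgroup[OF covering_subgroup_normal[of \<U> p]]]
  unfolding null_loop_def fundamental_group_one .

lemma null_loop_conjugate:
  assumes "null_loop \<U> p f" "loop_at p g"
  shows "null_loop \<U> p ((g +++ f) +++ reversepath g)"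
proof -
  have f: "loop_at p f" using assms null_loop_imp_loop by blast
  have "path_class g \<in> carrier (fundamental_group p)"
    using assms fundamental_group_carrier by blast
  with assms have "path_class g \<otimes>\<^bsub>fundamental_group p\<^esub> path_class f \<otimes>\<^bsub>fundamental_group p\<^esub>
      inv\<^bsub>fundamental_group p\<^esub> (path_class g) \<in> covering_subgroup \<U> p"
    unfolding null_loop_def by (intro normal.inv_op_closed2[OF covering_subgroup_normal])
  also have "path_class g \<otimes>\<^bsub>fundamental_group p\<^esub> path_class f \<otimes>\<^bsub>fundamental_group p\<^esub>
      inv\<^bsub>fundamental_group p\<^esub> (path_class g) = path_class ((g +++ f) +++ reversepath g)"
    using f assms(2) by (simp add: fundamental_group_mult fundamental_group_inv)
  finally show ?thesis unfolding null_loop_def .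
qed

lemma null_loop_generator:
  assumes "path \<alpha>" "pathstart \<alpha> = p" "path \<beta>" "pathstart \<beta> = pathfinish \<alpha>"
    "pathfinish \<beta> = pathstart \<beta>" "U \<in> \<U>" "path_image \<beta> \<subseteq> U"
  shows "null_loop \<U> p (\<alpha> +++ \<beta> +++ reversepath \<alpha>)"
  using assms unfolding null_loop_def covering_subgroup_def by blast

text \<open>Functoriality: the loops whose image under \<open>h\<close> is null form a normal subgroup, because \<open>h\<close> commutes
  with concatenation and reversal, and this subgroup contains the generators, because \<open>h\<close> sends a loop
  in a member of \<open>\<U>\<close> into a member of \<open>\<V>\<close>. By minimality it contains \<open>covering_subgroup \<U> p\<close>.\<close>

lemma null_loop_image:
  fixes h :: "'a::topological_space \<Rightarrow> 'b::topological_space"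
  assumes h: "continuous_on UNIV h" and ref: "\<And>U. U \<in> \<U> \<Longrightarrow> \<exists>V\<in>\<V>. h ` U \<subseteq> V"
    and n: "null_loop \<U> p \<gamma>"
  shows "null_loop \<V> (h p) (h \<circ> \<gamma>)"
proof -
  let ?G = "fundamental_group p"
  interpret G: group ?G by (rule group_fundamental_group)
  define N where "N = {path_class f | f. loop_at p f \<and> null_loop \<V> (h p) (h \<circ> f)}"
  have hp: "path (h \<circ> f)" if "path f" for f
    using that h by (intro path_continuous_image) (auto intro: continuous_on_subset)
  have NI: "path_class f \<in> N" if "loop_at p f" "null_loop \<V> (h p) (h \<circ> f)" for f
    using that unfolding N_def by blast
  have hc: "homotopic_paths UNIV (h \<circ> f) (h \<circ> g)" if "homotopic_paths UNIV f g" for f g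
    using that h by (rule homotopic_paths_continuous_image) auto
  have "N \<lhd> ?G"
  proof (rule G.normal_invI)
    show "subgroup N ?G"
    proof
      show "N \<subseteq> carrier ?G" unfolding N_def subset_iff fundamental_group_carrier by blast
      show "\<one>\<^bsub>?G\<^esub> \<in> N" unfolding fundamental_group_one
        by (rule NI) (simp_all add: comp_def null_loop_const)
      show "A \<otimes>\<^bsub>?G\<^esub> B \<in> N" if "A \<in> N" "B \<in> N" for A B
      proof -
        obtain f g where f: "loop_at p f" "null_loop \<V> (h p) (h \<circ> f)" "A = path_class f"
          and g: "loop_at p g" "null_loop \<V> (h p) (h \<circ> g)" "B = path_class g"
          using \<open>A \<in> N\<close> \<open>B \<in> N\<close> unfolding N_def by blast
        have "path_class (f +++ g) \<in> N"
          by (rule NI) (use f g in \<open>simp_all add: path_compose_join null_loop_join\<close>)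
        then show ?thesis using f g fundamental_group_mult by metis
      qed
      show "inv\<^bsub>?G\<^esub> A \<in> N" if A: "A \<in> N" for A
      proof -
        obtain f where f: "loop_at p f" "null_loop \<V> (h p) (h \<circ> f)" "A = path_class f"
          using A unfolding N_def by blast
        have "path_class (reversepath f) \<in> N"
          by (rule NI) (use f in \<open>simp_all add: path_compose_reversepath null_loop_reverse\<close>)
        then show ?thesis using f fundamental_group_inv by metis
      qed
    qed
    show "x \<otimes>\<^bsub>?G\<^esub> A \<otimes>\<^bsub>?G\<^esub> inv\<^bsub>?G\<^esub> x \<in> N" if x: "x \<in> carrier ?G" and A: "A \<in> N" for x A
    proof -
      obtain f where f: "loop_at p f" "null_loop \<V> (h p) (h \<circ> f)" "A = path_class f"
        using A unfolding N_def by blast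
      obtain g where g: "loop_at p g" "x = path_class g"
        using x unfolding fundamental_group_carrier by blast
      have "loop_at (h p) (h \<circ> g)" using g by (simp add: hp pathstart_compose pathfinish_compose)
      then have "path_class ((g +++ f) +++ reversepath g) \<in> N"
        by (intro NI) (use f g in \<open>simp_all add: path_compose_join path_compose_reversepath null_loop_conjugate\<close>)
      then show ?thesis using f g by (simp add: fundamental_group_mult fundamental_group_inv)
    qed
  qed
  moreover have "path_class (\<alpha> +++ \<beta> +++ reversepath \<alpha>) \<in> N"
    if *: "path \<alpha>" "pathstart \<alpha> = p" "path \<beta>" "pathstart \<beta> = pathfinish \<alpha>"
      "pathfinish \<beta> = pathstart \<beta>" "U \<in> \<U>" "path_image \<beta> \<subseteq> U" for \<alpha> \<beta> U
  proof (rule NI)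
    show "loop_at p (\<alpha> +++ \<beta> +++ reversepath \<alpha>)" using * by simp
    obtain V where V: "V \<in> \<V>" "h ` U \<subseteq> V" using ref * by blast
    have "null_loop \<V> (h p) ((h \<circ> \<alpha>) +++ (h \<circ> \<beta>) +++ reversepath (h \<circ> \<alpha>))"
      using * V hp by (intro null_loop_generator[of _ _ _ V])
        (auto simp: pathstart_compose pathfinish_compose path_image_compose)
    then show "null_loop \<V> (h p) (h \<circ> (\<alpha> +++ \<beta> +++ reversepath \<alpha>))"
      by (simp add: path_compose_join path_compose_reversepath)
  qed
  ultimately have "covering_subgroup \<U> p \<subseteq> N"
    unfolding covering_subgroup_def by blast
  then obtain f where f: "loop_at p f" "null_loop \<V> (h p) (h \<circ> f)" "path_class \<gamma> = path_class f"
    using n unfolding null_loop_def N_def by blast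
  have "homotopic_paths UNIV f \<gamma>" using f path_class_eq_iff by metis
  from null_loop_homotopic[OF hc[OF this]] f show ?thesis by blast
qed

section \<open>Points of the covering space\<close>

abbreviation path_from :: "'a::topological_space \<Rightarrow> (real \<Rightarrow> 'a) \<Rightarrow> bool" where
  "path_from p \<gamma> \<equiv> path \<gamma> \<and> pathstart \<gamma> = p"

text \<open>The sets \<open>cover_point \<U> p \<gamma>\<close> are the classes of an equivalence relation: reflexivity, symmetry and
  transitivity come from the unit, inverses and products in the covering subgroup.\<close>

lemma cover_point_eq_iff:
  assumes "path_from p \<gamma>" "path_from p \<gamma>'"
  shows "cover_point \<U> p \<gamma> = cover_point \<U> p \<gamma>' \<longleftrightarrow>
    pathfinish \<gamma> = pathfinish \<gamma>' \<and> null_loop \<U> p (\<gamma> +++ reversepath \<gamma>')"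
proof -
  define R where "R \<gamma> \<gamma>' \<longleftrightarrow> pathfinish \<gamma> = pathfinish \<gamma>' \<and> null_loop \<U> p (\<gamma> +++ reversepath \<gamma>')"
    for \<gamma> \<gamma>' :: "real \<Rightarrow> 'a"
  have cp: "cover_point \<U> p \<gamma> = {\<gamma>'. path_from p \<gamma>' \<and> R \<gamma> \<gamma>'}" for \<gamma>
    unfolding cover_point_def R_def null_loop_def by auto
  have refl: "R f f" if "path_from p f" for f
    using null_loop_homotopic[OF homotopic_paths_inverse_right, of f] that null_loop_const
    unfolding R_def by auto
  have sym: "R g f" if "R f g" for f g
    using null_loop_reverse[of \<U> p "f +++ reversepath g"] that unfolding R_def
    by (simp add: reversepath_joinpaths)
  have trans: "R f h" if "path_from p f" "path_from p g" "path_from p h" "R f g" "R g h" for f g h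
  proof -
    have "null_loop \<U> p ((f +++ reversepath g) +++ (g +++ reversepath h))"
      using that by (simp add: R_def null_loop_join)
    moreover have "homotopic_paths UNIV ((f +++ reversepath g) +++ (g +++ reversepath h)) (f +++ reversepath h)"
      using that by (intro homotopic_paths_cancel_middle) (auto simp: R_def)
    ultimately show ?thesis using null_loop_homotopic that unfolding R_def by auto
  qed
  have "cover_point \<U> p \<gamma> = cover_point \<U> p \<gamma>' \<longleftrightarrow> R \<gamma> \<gamma>'"
    unfolding cp using assms refl sym trans by blast
  then show ?thesis unfolding R_def .
qed

lemma cover_point_homotopic:
  assumes "homotopic_paths UNIV \<gamma> \<gamma>'" "pathstart \<gamma> = p"
  shows "cover_point \<U> p \<gamma> = cover_point \<U> p \<gamma>'"
proof -
  have *: "path_from p \<gamma>" "path_from p \<gamma>'" "pathfinish \<gamma> = pathfinish \<gamma>'"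
    using assms homotopic_paths_imp_path homotopic_paths_imp_pathstart homotopic_paths_imp_pathfinish by metis+
  have "homotopic_paths UNIV (\<gamma> +++ reversepath \<gamma>') (\<gamma>' +++ reversepath \<gamma>')"
    using * assms by (intro homotopic_paths_join) auto
  also have "homotopic_paths UNIV \<dots> (\<lambda>_. p)"
    using homotopic_paths_inverse_right[of \<gamma>'] * by simp
  finally have "null_loop \<U> p (\<gamma> +++ reversepath \<gamma>')"
    using null_loop_homotopic null_loop_const by blast
  then show ?thesis using cover_point_eq_iff * by blast
qed

lemma cover_proj_cover_point:
  assumes "path_from p \<gamma>"
  shows "cover_proj (cover_point \<U> p \<gamma>) = pathfinish \<gamma>"
proof -
  have "\<gamma> \<in> cover_point \<U> p \<gamma>"
    using cover_point_eq_iff[OF assms assms, of \<U>] assms unfolding cover_point_def null_loop_def by auto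
  then have "pathfinish ` cover_point \<U> p \<gamma> = {pathfinish \<gamma>}"
    unfolding cover_point_def by auto
  then show ?thesis by (simp add: cover_proj_def)
qed

lemma cover_point_join_const:
  assumes "path_from p \<gamma>" "x = pathfinish \<gamma>"
  shows "cover_point \<U> p (\<gamma> +++ (\<lambda>_. x)) = cover_point \<U> p \<gamma>"
  using assms by (intro cover_point_homotopic homotopic_paths_const_right) auto

text \<open>A common prolongation cancels in \<open>(\<gamma> +++ \<eta>) +++ reversepath (\<gamma>' +++ \<eta>)\<close>.\<close>

lemma cover_point_join_right:
  assumes "path_from p \<gamma>" "path_from p \<gamma>'" "path \<eta>" "pathstart \<eta> = pathfinish \<gamma>"
    and "pathfinish \<gamma> = pathfinish \<gamma>'"
  shows "cover_point \<U> p (\<gamma> +++ \<eta>) = cover_point \<U> p (\<gamma>' +++ \<eta>) \<longleftrightarrow>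
    cover_point \<U> p \<gamma> = cover_point \<U> p \<gamma>'"
proof -
  have "homotopic_paths UNIV ((\<gamma> +++ reversepath (reversepath \<eta>)) +++ (reversepath \<eta> +++ reversepath \<gamma>'))
     (\<gamma> +++ reversepath \<gamma>')"
    by (rule homotopic_paths_cancel_middle) (use assms in auto)
  then have "homotopic_paths UNIV ((\<gamma> +++ \<eta>) +++ reversepath (\<gamma>' +++ \<eta>)) (\<gamma> +++ reversepath \<gamma>')"
    using assms by (simp add: reversepath_joinpaths)
  then show ?thesis
    using assms null_loop_homotopic by (subst (1 2) cover_point_eq_iff) auto
qed

lemma cover_point_join_assoc:
  assumes "path_from p \<gamma>" "path \<eta>" "pathstart \<eta> = pathfinish \<gamma>" "path \<zeta>" "pathstart \<zeta> = pathfinish \<eta>"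
  shows "cover_point \<U> p (\<gamma> +++ (\<eta> +++ \<zeta>)) = cover_point \<U> p ((\<gamma> +++ \<eta>) +++ \<zeta>)"
  using assms by (intro cover_point_homotopic homotopic_paths_assoc_UNIV) auto

lemma cover_point_join_cancel:
  assumes "path_from p \<gamma>" "path \<eta>" "pathstart \<eta> = pathfinish \<gamma>"
  shows "cover_point \<U> p ((\<gamma> +++ \<eta>) +++ reversepath \<eta>) = cover_point \<U> p \<gamma>"
proof -
  have "cover_point \<U> p ((\<gamma> +++ \<eta>) +++ reversepath \<eta>) = cover_point \<U> p (\<gamma> +++ (\<eta> +++ reversepath \<eta>))"
    using assms by (intro cover_point_join_assoc[symmetric]) auto
  also have "\<dots> = cover_point \<U> p (\<gamma> +++ (\<lambda>_. pathstart \<eta>))"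
    using assms by (intro cover_point_homotopic homotopic_paths_join homotopic_paths_inverse_right) auto
  finally show ?thesis using assms by (simp add: cover_point_join_const)
qed

text \<open>Two prolongations inside one member of the covering differ by a generator
  \<open>\<gamma> +++ \<beta> +++ reversepath \<gamma>\<close> with \<open>\<beta> = \<eta> +++ reversepath \<eta>'\<close>; this is why the projection is injective
  on small sheets.\<close>

lemma cover_point_join_local:
  assumes "path_from p \<gamma>" "path \<eta>" "pathstart \<eta> = pathfinish \<gamma>" "path \<eta>'" "pathstart \<eta>' = pathfinish \<gamma>"
    and "pathfinish \<eta> = pathfinish \<eta>'" "U \<in> \<U>" "path_image \<eta> \<subseteq> U" "path_image \<eta>' \<subseteq> U"
  shows "cover_point \<U> p (\<gamma> +++ \<eta>) = cover_point \<U> p (\<gamma> +++ \<eta>')"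
proof -
  have "null_loop \<U> p (\<gamma> +++ (\<eta> +++ reversepath \<eta>') +++ reversepath \<gamma>)"
    using assms by (intro null_loop_generator[of _ _ _ U]) (auto simp: path_image_join)
  moreover have "homotopic_paths UNIV (\<gamma> +++ (\<eta> +++ reversepath \<eta>') +++ reversepath \<gamma>)
      (\<gamma> +++ (\<eta> +++ (reversepath \<eta>' +++ reversepath \<gamma>)))"
    using assms by (intro homotopic_paths_join homotopic_paths_sym[OF homotopic_paths_assoc_UNIV]) auto
  moreover have "homotopic_paths UNIV (\<gamma> +++ (\<eta> +++ (reversepath \<eta>' +++ reversepath \<gamma>)))
      ((\<gamma> +++ \<eta>) +++ (reversepath \<eta>' +++ reversepath \<gamma>))"
    using assms by (intro homotopic_paths_assoc_UNIV) auto
  ultimately have "null_loop \<U> p ((\<gamma> +++ \<eta>) +++ reversepath (\<gamma> +++ \<eta>'))"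
    using assms null_loop_homotopic by (simp add: reversepath_joinpaths) blast
  then show ?thesis using assms by (subst cover_point_eq_iff) auto
qed

section \<open>Sheets and the topology of the covering space\<close>

text \<open>The members of the subbasis that generates the topology. If \<open>\<gamma>\<close> ends in \<open>V\<close>, then the sheet is a
  neighbourhood of the class of \<open>\<gamma>\<close>.\<close>

definition sheet :: "'a::topological_space set set \<Rightarrow> 'a \<Rightarrow> (real \<Rightarrow> 'a) \<Rightarrow> 'a set \<Rightarrow> (real \<Rightarrow> 'a) set set" where
  "sheet \<U> p \<gamma> V =
    {cover_point \<U> p (\<gamma> +++ \<eta>) | \<eta>. path \<eta> \<and> pathstart \<eta> = pathfinish \<gamma> \<and> path_image \<eta> \<subseteq> V}"

lemma cover_space_alt:
  "cover_space \<U> p = topology_generated_by {sheet \<U> p \<gamma> V | \<gamma> V. path_from p \<gamma> \<and> open V}"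
  unfolding cover_space_def sheet_def by simp

lemma sheetI:
  "path \<eta> \<Longrightarrow> pathstart \<eta> = pathfinish \<gamma> \<Longrightarrow> path_image \<eta> \<subseteq> V \<Longrightarrow>
    e = cover_point \<U> p (\<gamma> +++ \<eta>) \<Longrightarrow> e \<in> sheet \<U> p \<gamma> V"
  unfolding sheet_def by blast

lemma sheet_self:
  assumes "path_from p \<gamma>" "pathfinish \<gamma> \<in> V"
  shows "cover_point \<U> p \<gamma> \<in> sheet \<U> p \<gamma> V"
proof (rule sheetI[of "\<lambda>_. pathfinish \<gamma>"])
  show "path_image (\<lambda>_. pathfinish \<gamma>) \<subseteq> V" using assms by (auto simp: path_image_def)
  show "cover_point \<U> p \<gamma> = cover_point \<U> p (\<gamma> +++ (\<lambda>_. pathfinish \<gamma>))"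
    using cover_point_join_const[OF assms(1) refl] by simp
qed auto

text \<open>A sheet may be based at any of its points: if \<open>\<gamma>'\<close> is equivalent to \<open>\<gamma> +++ \<eta>\<close>, a prolongation of \<open>\<gamma>'\<close> by
  \<open>\<zeta>\<close> is one of \<open>\<gamma>\<close> by \<open>\<eta> +++ \<zeta>\<close>, and conversely with the reverse of \<open>\<eta>\<close>. In particular two sheets over
  the same \<open>V\<close> are equal or disjoint.\<close>

lemma sheet_shift:
  assumes "path_from p \<gamma>" "path_from p \<gamma>'" "cover_point \<U> p \<gamma>' \<in> sheet \<U> p \<gamma> V"
  shows "sheet \<U> p \<gamma>' V = sheet \<U> p \<gamma> V"
proof -
  have sub: "sheet \<U> p g V \<subseteq> sheet \<U> p f V"
    if f: "path_from p f" "path_from p g" "path \<eta>" "pathstart \<eta> = pathfinish f" "path_image \<eta> \<subseteq> V"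
      "cover_point \<U> p g = cover_point \<U> p (f +++ \<eta>)" for f g \<eta>
  proof
    fix e assume "e \<in> sheet \<U> p g V"
    then obtain \<zeta> where z: "path \<zeta>" "pathstart \<zeta> = pathfinish g" "path_image \<zeta> \<subseteq> V"
      "e = cover_point \<U> p (g +++ \<zeta>)" unfolding sheet_def by blast
    have fin: "pathfinish g = pathfinish \<eta>"
      using f cover_point_eq_iff[of g p "f +++ \<eta>" \<U>] by simp
    have "e = cover_point \<U> p ((f +++ \<eta>) +++ \<zeta>)"
      unfolding z using f z fin by (subst cover_point_join_right) auto
    also have "\<dots> = cover_point \<U> p (f +++ (\<eta> +++ \<zeta>))"
      using f z fin by (subst cover_point_join_assoc) auto
    finally show "e \<in> sheet \<U> p f V"
      using f z fin by (intro sheetI[of "\<eta> +++ \<zeta>"]) (auto simp: path_image_join)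
  qed
  obtain \<eta> where e: "path \<eta>" "pathstart \<eta> = pathfinish \<gamma>" "path_image \<eta> \<subseteq> V"
    "cover_point \<U> p \<gamma>' = cover_point \<U> p (\<gamma> +++ \<eta>)" using assms(3) unfolding sheet_def by blast
  have fin: "pathfinish \<gamma>' = pathfinish \<eta>"
    using e assms cover_point_eq_iff[of \<gamma>' p "\<gamma> +++ \<eta>" \<U>] by simp
  have "cover_point \<U> p \<gamma> = cover_point \<U> p ((\<gamma> +++ \<eta>) +++ reversepath \<eta>)"
    using assms e by (simp add: cover_point_join_cancel)
  also have "\<dots> = cover_point \<U> p (\<gamma>' +++ reversepath \<eta>)"
    using assms e fin by (subst cover_point_join_right) auto
  finally have "sheet \<U> p \<gamma> V \<subseteq> sheet \<U> p \<gamma>' V"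
    using assms e fin by (intro sub[of _ _ "reversepath \<eta>"]) auto
  then show ?thesis using sub[OF assms(1,2) e] by blast
qed

lemma topspace_cover_space: "topspace (cover_space \<U> p) = {cover_point \<U> p \<gamma> | \<gamma>. path_from p \<gamma>}"
proof (intro equalityI subsetI)
  fix e assume "e \<in> topspace (cover_space \<U> p)"
  then obtain \<gamma> V where g: "path_from p \<gamma>" "e \<in> sheet \<U> p \<gamma> V"
    unfolding cover_space_alt topology_generated_by_topspace by blast
  then obtain \<eta> where e: "path \<eta>" "pathstart \<eta> = pathfinish \<gamma>" "e = cover_point \<U> p (\<gamma> +++ \<eta>)"
    unfolding sheet_def by blast
  have "path_from p (\<gamma> +++ \<eta>)" using g e by simp
  then show "e \<in> {cover_point \<U> p \<gamma> | \<gamma>. path_from p \<gamma>}" using e(3) by blast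
next
  fix e assume "e \<in> {cover_point \<U> p \<gamma> | \<gamma>. path_from p \<gamma>}"
  then obtain \<gamma> where g: "path_from p \<gamma>" "e = cover_point \<U> p \<gamma>" by blast
  have "e \<in> sheet \<U> p \<gamma> UNIV" unfolding g(2) by (rule sheet_self[OF g(1) UNIV_I])
  moreover have "sheet \<U> p \<gamma> UNIV \<in> {sheet \<U> p \<gamma> V | \<gamma> V. path_from p \<gamma> \<and> open V}"
    using g(1) open_UNIV by blast
  ultimately show "e \<in> topspace (cover_space \<U> p)"
    unfolding cover_space_alt topology_generated_by_topspace by (rule UnionI[rotated])
qed

lemma openin_sheet: "path_from p \<gamma> \<Longrightarrow> open V \<Longrightarrow> openin (cover_space \<U> p) (sheet \<U> p \<gamma> V)"
  unfolding cover_space_alt by (rule topology_generated_by_Basis) blast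

text \<open>By \<open>sheet_shift\<close> it suffices to test continuity at \<open>x\<close> on sheets based at the image of \<open>x\<close>.\<close>

lemma continuous_map_into_cover_space:
  assumes top: "\<And>x. x \<in> topspace T \<Longrightarrow> f x \<in> topspace (cover_space \<U> p)"
    and nbhd: "\<And>x \<gamma> V. x \<in> topspace T \<Longrightarrow> path_from p \<gamma> \<Longrightarrow> f x = cover_point \<U> p \<gamma> \<Longrightarrow> open V \<Longrightarrow>
      pathfinish \<gamma> \<in> V \<Longrightarrow> \<exists>W. openin T W \<and> x \<in> W \<and> f ` W \<subseteq> sheet \<U> p \<gamma> V"
  shows "continuous_map T (cover_space \<U> p) f"
proof -
  have "openin T (f -` sheet \<U> p \<gamma> V \<inter> topspace T)" if g: "path_from p \<gamma>" "open V" for \<gamma> V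
  proof (subst openin_subopen, intro ballI)
    fix x assume x: "x \<in> f -` sheet \<U> p \<gamma> V \<inter> topspace T"
    then obtain \<eta> where e: "path \<eta>" "pathstart \<eta> = pathfinish \<gamma>" "path_image \<eta> \<subseteq> V"
      "f x = cover_point \<U> p (\<gamma> +++ \<eta>)" unfolding sheet_def by blast
    have "pathfinish (\<gamma> +++ \<eta>) \<in> V" using e pathfinish_in_path_image[of \<eta>] by auto
    then obtain W where W: "openin T W" "x \<in> W" "f ` W \<subseteq> sheet \<U> p (\<gamma> +++ \<eta>) V"
      using nbhd[of x "\<gamma> +++ \<eta>" V] x e g by auto
    have "sheet \<U> p (\<gamma> +++ \<eta>) V = sheet \<U> p \<gamma> V"
      using e g x by (intro sheet_shift) auto
    then show "\<exists>W. openin T W \<and> x \<in> W \<and> W \<subseteq> f -` sheet \<U> p \<gamma> V \<inter> topspace T"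
      using W openin_subset[OF W(1)] by blast
  qed
  moreover have "f ` topspace T \<subseteq> topspace (cover_space \<U> p)" using top by blast
  ultimately show ?thesis
    unfolding cover_space_alt by (intro continuous_on_generated_topo) auto
qed

lemma continuous_map_cover_proj: "continuous_map (cover_space \<U> p) euclidean cover_proj"
proof -
  have "openin (cover_space \<U> p) {e \<in> topspace (cover_space \<U> p). cover_proj e \<in> V}" if V: "open V" for V
  proof (subst openin_subopen, intro ballI)
    fix e assume e: "e \<in> {e \<in> topspace (cover_space \<U> p). cover_proj e \<in> V}"
    then obtain \<gamma> where g0: "path_from p \<gamma>" "e = cover_point \<U> p \<gamma>" "cover_proj e \<in> V"
      unfolding topspace_cover_space by blast
    then have g: "path_from p \<gamma>" "e = cover_point \<U> p \<gamma>" "pathfinish \<gamma> \<in> V"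
      using cover_proj_cover_point[OF g0(1), of \<U>] by simp_all
    have "e' \<in> topspace (cover_space \<U> p) \<and> cover_proj e' \<in> V" if s: "e' \<in> sheet \<U> p \<gamma> V" for e'
    proof
      show "e' \<in> topspace (cover_space \<U> p)" using s openin_sheet[OF g(1) V] openin_subset by blast
      obtain \<eta> where "path \<eta>" "pathstart \<eta> = pathfinish \<gamma>" "path_image \<eta> \<subseteq> V" 
        "e' = cover_point \<U> p (\<gamma> +++ \<eta>)" using s unfolding sheet_def by blast
      then show "cover_proj e' \<in> V"
        using g pathfinish_in_path_image[of \<eta>] cover_proj_cover_point[of "\<gamma> +++ \<eta>" p \<U>] by auto
    qed
    moreover have "e \<in> sheet \<U> p \<gamma> V" using g sheet_self by blast
    ultimately show "\<exists>T. openin (cover_space \<U> p) T \<and> e \<in> T \<and>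
        T \<subseteq> {e \<in> topspace (cover_space \<U> p). cover_proj e \<in> V}"
      using openin_sheet[OF g(1) V] by (intro exI[of _ "sheet \<U> p \<gamma> V"] conjI subsetI CollectI) auto
  qed
  then show ?thesis by (auto simp: continuous_map_def)
qed

section \<open>Lifts of paths\<close>

text \<open>The lift of \<open>\<eta>\<close> at the class of \<open>\<gamma>\<close> sends \<open>t\<close> to the class of \<open>\<gamma>\<close> prolonged by the part of \<open>\<eta>\<close> up to \<open>t\<close>. It is
  continuous because, for \<open>s\<close> near \<open>t\<close>, the part of \<open>\<eta>\<close> between \<open>t\<close> and \<open>s\<close> stays in a given neighbourhood
  of \<open>\<eta> t\<close>.\<close>

lemma pathin_lift:
  fixes \<eta> :: "real \<Rightarrow> 'a::topological_space"
  assumes g: "path_from p \<gamma>" and e: "path \<eta>" "pathstart \<eta> = pathfinish \<gamma>"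
  shows "pathin (cover_space \<U> p) (\<lambda>t. cover_point \<U> p (\<gamma> +++ (\<eta> \<circ> linepath 0 t)))"
    (is "pathin _ ?c")
  unfolding pathin_def
proof (rule continuous_map_into_cover_space)
  have seg: "path (\<eta> \<circ> linepath u v)" "pathstart (\<eta> \<circ> linepath u v) = \<eta> u" 
     "pathfinish (\<eta> \<circ> linepath u v) = \<eta> v"
    if "u \<in> {0..1}" "v \<in> {0..1}" for u v
    using that e path_compose_linepath by (auto simp: pathstart_compose pathfinish_compose)
  have e0: "\<eta> 0 = pathfinish \<gamma>" using e by (simp add: pathstart_def)
  have from_p: "path_from p (\<gamma> +++ (\<eta> \<circ> linepath 0 t))" if "t \<in> {0..1}" for t
    using g e0 seg[OF _ that, of 0] by simp
  show "?c t \<in> topspace (cover_space \<U> p)" if "t \<in> topspace (top_of_set {0..1})" for t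
    unfolding topspace_cover_space using that from_p[of t] by (intro CollectI exI[of _ "\<gamma> +++ (\<eta> \<circ> linepath 0 t)"]) simp
  fix t \<gamma>' V
  assume "t \<in> topspace (top_of_set {0..1::real})" and g': "path_from p \<gamma>'" 
    and eq: "?c t = cover_point \<U> p \<gamma>'" and V: "open V" "pathfinish \<gamma>' \<in> V"
  then have t: "t \<in> {0..1}" by simp
  have fin: "pathfinish \<gamma>' = \<eta> t"
    using eq cover_point_eq_iff[OF from_p[OF t] g'] seg[of 0 t] t by simp
  have "continuous_on {0..1} \<eta>" using e by (simp add: path_def)
  then obtain A where A: "open A" "A \<inter> {0..1} = \<eta> -` V \<inter> {0..1}"
    using V(1) unfolding continuous_on_open_invariant by blast
  then have "t \<in> A" using t V(2) unfolding fin by blast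
  then obtain d where d: "d > 0" "ball t d \<subseteq> A" using A openE by blast
  let ?W = "{0..1} \<inter> ball t d"
  have "?c s \<in> sheet \<U> p \<gamma>' V" if s: "s \<in> ?W" for s
  proof (rule sheetI[of "\<eta> \<circ> linepath t s"])
    have s1: "s \<in> {0..1}" using s by simp
    show "path (\<eta> \<circ> linepath t s)" "pathstart (\<eta> \<circ> linepath t s) = pathfinish \<gamma>'"
      using seg[OF t s1] fin by simp_all
    have "closed_segment t s \<subseteq> {0..1} \<inter> ball t d"
      using t s d by (intro closed_segment_subset convex_Int) simp_all
    then show "path_image (\<eta> \<circ> linepath t s) \<subseteq> V"
      unfolding path_image_compose path_image_linepath using A d by blast
    have "?c s = cover_point \<U> p (\<gamma> +++ ((\<eta> \<circ> linepath 0 t) +++ (\<eta> \<circ> linepath t s)))"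
      using g e t s1 seg[of 0 t] seg[of 0 s]
      by (intro cover_point_homotopic homotopic_paths_join homotopic_paths_sym[OF homotopic_paths_segment_join])
         (simp_all add: e0)
    also have "\<dots> = cover_point \<U> p ((\<gamma> +++ (\<eta> \<circ> linepath 0 t)) +++ (\<eta> \<circ> linepath t s))"
      using g e t s1 seg[of 0 t] seg[of t s]
      by (intro cover_point_join_assoc) (simp_all add: e0)
    also have "\<dots> = cover_point \<U> p (\<gamma>' +++ (\<eta> \<circ> linepath t s))"
      using eq g' from_p[OF t] seg[of 0 t] seg[of t s] t s1 fin
      by (subst cover_point_join_right) simp_all
    finally show "?c s = cover_point \<U> p (\<gamma>' +++ (\<eta> \<circ> linepath t s))" .
  qed
  moreover have "openin (top_of_set {0..1}) ?W" by (simp add: openin_open_Int)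
  ultimately show "\<exists>W. openin (top_of_set {0..1}) W \<and> t \<in> W \<and> ?c ` W \<subseteq> sheet \<U> p \<gamma>' V"
    using t d by (intro exI[of _ ?W] conjI image_subsetI) simp_all
qed

lemma lift_start:
  assumes "path_from p \<gamma>" "pathstart \<eta> = pathfinish \<gamma>"
  shows "cover_point \<U> p (\<gamma> +++ (\<eta> \<circ> linepath 0 0)) = cover_point \<U> p \<gamma>"
proof -
  have "\<eta> \<circ> linepath 0 0 = (\<lambda>_. pathfinish \<gamma>)"
    using assms by (auto simp: linepath_def pathstart_def)
  then show ?thesis using assms cover_point_join_const by metis
qed

lemma lift_finish: "cover_point \<U> p (\<gamma> +++ (\<eta> \<circ> linepath 0 1)) = cover_point \<U> p (\<gamma> +++ \<eta>)"
proof -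
  have "\<eta> \<circ> linepath 0 1 = \<eta>" by (auto simp: linepath_def)
  then show ?thesis by simp
qed

lemma cover_proj_lift:
  assumes "path_from p \<gamma>" "path \<eta>" "pathstart \<eta> = pathfinish \<gamma>" "t \<in> {0..1}"
  shows "cover_proj (cover_point \<U> p (\<gamma> +++ (\<eta> \<circ> linepath 0 t))) = \<eta> t"
  using assms path_compose_linepath[of \<eta> 0 t]
  by (subst cover_proj_cover_point) (auto simp: pathstart_compose pathfinish_compose pathstart_def[of \<eta>] simp flip: pathstart_def[of \<gamma>])

lemma path_connected_cover_space: "path_connected_space (cover_space \<U> p)"
proof -
  let ?b = "cover_point \<U> p (\<lambda>_. p)"
  have "path_component_of (cover_space \<U> p) ?b e" if e: "e \<in> topspace (cover_space \<U> p)" for e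
  proof -
    obtain \<gamma> where g: "path_from p \<gamma>" "e = cover_point \<U> p \<gamma>"
      using e unfolding topspace_cover_space by blast
    let ?c = "\<lambda>t. cover_point \<U> p ((\<lambda>_. p) +++ (\<gamma> \<circ> linepath 0 t))"
    have "pathin (cover_space \<U> p) ?c" using g by (intro pathin_lift) auto
    moreover have "?c 0 = ?b" using g by (intro lift_start) auto
    moreover have "?c 1 = e"
      unfolding lift_finish g using g by (intro cover_point_homotopic homotopic_paths_const_left) auto
    ultimately show ?thesis unfolding path_component_of_def by blast
  qed
  then show ?thesis
    unfolding path_connected_space_iff_path_component
    using path_component_of_sym[of "cover_space \<U> p" ?b]
      path_component_of_trans[of "cover_space \<U> p" _ ?b] by blast
qed

section \<open>Geodesics parametrised with constant speed\<close>

text \<open>Geodesics with a parametrisation that is proportional to arc length. Unlike the geodesics of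
  \<open>geodesic_space\<close>, whose parametrisation is arbitrary, two of these can be paired to a geodesic of
  the product.\<close>

definition lipschitz_geodesics :: "'a::metric_space itself \<Rightarrow> bool" where
  "lipschitz_geodesics (_ :: 'a itself) \<longleftrightarrow>
     (\<forall>x y :: 'a. \<exists>\<sigma>. \<sigma> 0 = x \<and> \<sigma> 1 = y \<and>
        (\<forall>s\<in>{0..1}. \<forall>t\<in>{0..1}. dist (\<sigma> s) (\<sigma> t) \<le> dist x y * \<bar>s - t\<bar>))"

lemma curve_length_ge_polygon:
  assumes "t 0 = 0" "t n = 1" "\<And>i. i < n \<Longrightarrow> t i \<le> t (Suc i)"
  shows "(\<Sum>i<n. ennreal (dist (\<gamma> (t i)) (\<gamma> (t (Suc i))))) \<le> curve_length \<gamma>"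
  unfolding curve_length_def
  by (rule SUP_upper2[of "(n, t)"]) (use assms in auto)

text \<open>On a curve \<open>\<gamma>\<close> whose length is the distance of its ends \<open>x\<close> and \<open>y\<close>, all triangle inequalities between
  successive points are equalities. Hence \<open>dist (\<gamma> s) (\<gamma> t)\<close> is the difference of the distances from \<open>x\<close>,
  and sending \<open>r\<close> to any point of \<open>\<gamma>\<close> at distance \<open>r * dist x y\<close> from \<open>x\<close>, which exists by the intermediate
  value theorem, gives the required parametrisation.\<close>

lemma geodesic_space_imp_lipschitz_geodesics:
  assumes "geodesic_space TYPE('a::metric_space)"
  shows "lipschitz_geodesics TYPE('a)"
  unfolding lipschitz_geodesics_def
proof (intro allI)
  fix x y :: 'a
  obtain \<gamma> where g: "path \<gamma>" "\<gamma> 0 = x" "\<gamma> 1 = y" "ennreal (dist x y) = curve_length \<gamma>"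
    using assms unfolding geodesic_space_def pathstart_def pathfinish_def by meson
  \<comment> \<open>The polygon through two points of the curve is no longer than the curve itself.\<close>
  have three: "dist x (\<gamma> s) + dist (\<gamma> s) (\<gamma> t) + dist (\<gamma> t) y \<le> dist x y"
    if "0 \<le> s" "s \<le> t" "t \<le> 1" for s t
  proof -
    let ?u = "\<lambda>i::nat. if i = 0 then 0 else if i = 1 then s else if i = 2 then t else 1"
    have "(\<Sum>i<3. ennreal (dist (\<gamma> (?u i)) (\<gamma> (?u (Suc i))))) \<le> curve_length \<gamma>"
      by (rule curve_length_ge_polygon) (use that in auto)
    then have "ennreal (dist x (\<gamma> s) + dist (\<gamma> s) (\<gamma> t) + dist (\<gamma> t) y) \<le> ennreal (dist x y)"
      using g by (simp add: eval_nat_numeral add.assoc)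
    then show ?thesis by (simp del: ennreal_plus add: ennreal_le_iff)
  qed
  have "\<exists>t\<in>{0..1}. dist x (\<gamma> t) = r * dist x y" if r: "r \<in> {0..1}" for r
  proof -
    have "continuous_on {0..1} (\<lambda>t. dist x (\<gamma> t))"
      using g by (intro continuous_intros) (simp add: path_def)
    moreover have "r * dist x y \<le> dist x y"
      using r mult_right_mono[of r 1 "dist x y"] by simp
    ultimately show ?thesis
      using IVT'[of "\<lambda>t. dist x (\<gamma> t)" 0 "r * dist x y" 1] g r by auto
  qed
  then obtain \<tau> where tau: "\<And>r. r \<in> {0..1} \<Longrightarrow> \<tau> r \<in> {0..1} \<and> dist x (\<gamma> (\<tau> r)) = r * dist x y"
    by metis
  have le: "dist (\<gamma> (\<tau> r)) (\<gamma> (\<tau> r')) \<le> dist x y * \<bar>r - r'\<bar>"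
    if r: "r \<in> {0..1}" "r' \<in> {0..1}" "\<tau> r \<le> \<tau> r'" for r r'
  proof -
    have "dist x (\<gamma> (\<tau> r)) + dist (\<gamma> (\<tau> r)) (\<gamma> (\<tau> r')) + dist (\<gamma> (\<tau> r')) y \<le> dist x y"
      using tau r by (intro three) auto
    moreover have "dist x y \<le> dist x (\<gamma> (\<tau> r')) + dist (\<gamma> (\<tau> r')) y" by (rule dist_triangle)
    ultimately have "dist (\<gamma> (\<tau> r)) (\<gamma> (\<tau> r')) \<le> (r' - r) * dist x y"
      using tau[OF r(1)] tau[OF r(2)] by (simp add: algebra_simps)
    also have "\<dots> \<le> \<bar>r - r'\<bar> * dist x y" by (intro mult_right_mono) auto
    finally show ?thesis by (simp add: mult.commute)
  qed
  have "dist (\<gamma> (\<tau> r)) (\<gamma> (\<tau> r')) \<le> dist x y * \<bar>r - r'\<bar>" if "r \<in> {0..1}" "r' \<in> {0..1}" for r r'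
    using le[of r r'] le[of r' r] that by (cases "\<tau> r \<le> \<tau> r'") (auto simp: dist_commute abs_minus_commute)
  moreover have "\<gamma> (\<tau> 0) = x" using tau[of 0] by simp
  moreover have "\<gamma> (\<tau> 1) = y"
    using tau[of 1] three[of "\<tau> 1" "\<tau> 1"] by simp
  ultimately show "\<exists>\<sigma>. \<sigma> 0 = x \<and> \<sigma> 1 = y \<and>
        (\<forall>s\<in>{0..1}. \<forall>t\<in>{0..1}. dist (\<sigma> s) (\<sigma> t) \<le> dist x y * \<bar>s - t\<bar>)"
    by (intro exI[of _ "\<gamma> \<circ> \<tau>"]) auto
qed

text \<open>Curves of speeds \<open>l\<close> and \<open>m\<close> in the factors combine to a curve of speed \<open>sqrt (l\<^sup>2 + m\<^sup>2)\<close>.\<close>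

lemma dist_Pair_scale:
  fixes a a' :: "'a::metric_space" and b b' :: "'b::metric_space"
  assumes "dist a a' \<le> l * r" "dist b b' \<le> m * r" "0 \<le> r"
  shows "dist (a, b) (a', b') \<le> sqrt (l\<^sup>2 + m\<^sup>2) * r"
proof -
  have "(dist a a')\<^sup>2 \<le> (l * r)\<^sup>2" "(dist b b')\<^sup>2 \<le> (m * r)\<^sup>2"
    using assms by (intro power_mono; simp)+
  then have "dist (a, b) (a', b') \<le> sqrt ((l * r)\<^sup>2 + (m * r)\<^sup>2)"
    by (simp add: dist_Pair_Pair)
  also have "\<dots> = sqrt ((l\<^sup>2 + m\<^sup>2) * r\<^sup>2)" by (simp add: algebra_simps power_mult_distrib)
  also have "\<dots> = sqrt (l\<^sup>2 + m\<^sup>2) * r" using assms by (simp add: real_sqrt_mult)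
  finally show ?thesis .
qed

lemma lipschitz_geodesics_prod:
  assumes "lipschitz_geodesics TYPE('a::metric_space)" "lipschitz_geodesics TYPE('b::metric_space)"
  shows "lipschitz_geodesics TYPE('a \<times> 'b)"
  unfolding lipschitz_geodesics_def
proof (intro allI)
  fix x y :: "'a \<times> 'b"
  obtain \<sigma> where s: "\<sigma> 0 = fst x" "\<sigma> 1 = fst y"
    "\<And>s t. s \<in> {0..1} \<Longrightarrow> t \<in> {0..1} \<Longrightarrow> dist (\<sigma> s) (\<sigma> t) \<le> dist (fst x) (fst y) * \<bar>s - t\<bar>"
    using assms(1) unfolding lipschitz_geodesics_def by metis
  obtain \<rho> where r: "\<rho> 0 = snd x" "\<rho> 1 = snd y"
    "\<And>s t. s \<in> {0..1} \<Longrightarrow> t \<in> {0..1} \<Longrightarrow> dist (\<rho> s) (\<rho> t) \<le> dist (snd x) (snd y) * \<bar>s - t\<bar>"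
    using assms(2) unfolding lipschitz_geodesics_def by metis
  show "\<exists>\<tau>. \<tau> 0 = x \<and> \<tau> 1 = y \<and>
        (\<forall>s\<in>{0..1}. \<forall>t\<in>{0..1}. dist (\<tau> s) (\<tau> t) \<le> dist x y * \<bar>s - t\<bar>)"
  proof (intro exI[of _ "\<lambda>t. (\<sigma> t, \<rho> t)"] conjI ballI)
    fix u t :: real assume "u \<in> {0..1}" "t \<in> {0..1}"
    then have "dist (\<sigma> u, \<rho> u) (\<sigma> t, \<rho> t) \<le>
        sqrt ((dist (fst x) (fst y))\<^sup>2 + (dist (snd x) (snd y))\<^sup>2) * \<bar>u - t\<bar>"
      by (intro dist_Pair_scale s r) auto
    then show "dist (\<sigma> u, \<rho> u) (\<sigma> t, \<rho> t) \<le> dist x y * \<bar>u - t\<bar>"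
      by (simp add: dist_prod_def)
  qed (use s r in auto)
qed

text \<open>A shortest curve from the centre never moves farther away than its end point.\<close>

lemma path_in_ball:
  fixes x y :: "'a::metric_space"
  assumes "lipschitz_geodesics TYPE('a)" "y \<in> ball x r"
  obtains \<eta> where "path \<eta>" "pathstart \<eta> = x" "pathfinish \<eta> = y" "path_image \<eta> \<subseteq> ball x r"
proof -
  obtain \<sigma> where s: "\<sigma> 0 = x" "\<sigma> 1 = y"
    "\<And>s t. s \<in> {0..1} \<Longrightarrow> t \<in> {0..1} \<Longrightarrow> dist (\<sigma> s) (\<sigma> t) \<le> dist x y * \<bar>s - t\<bar>"
    using assms(1) unfolding lipschitz_geodesics_def by metis
  have "continuous_on {0..1} \<sigma>"
    by (rule lipschitz_on_continuous_on[of "dist x y"], rule lipschitz_onI)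
      (use s in \<open>auto simp: dist_real_def\<close>)
  moreover have "path_image \<sigma> \<subseteq> ball x r"
  proof -
    have "dist x (\<sigma> t) < r" if "t \<in> {0..1}" for t
    proof -
      have "dist x (\<sigma> t) \<le> dist x y * t" using s(3)[of 0 t] that s(1) by simp
      also have "\<dots> \<le> dist x y" using that mult_left_mono[of t 1 "dist x y"] by simp
      finally show ?thesis using assms(2) by simp
    qed
    then show ?thesis unfolding path_image_def by auto
  qed
  ultimately show thesis
    using that[of \<sigma>] s by (simp add: path_def pathstart_def pathfinish_def)
qed

section \<open>Local sections over balls and unique lifting\<close>

text \<open>Balls of radius \<open>\<delta>\<close> have a continuous section through every point above their centre, and a path
  that starts at this point and projects into the ball lies on the section. This weak form of being
  evenly covered is all that unique lifting and the comparison of metrics use, and it makes sense for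
  an arbitrary map \<open>\<pi>\<close>.\<close>

definition sections_over_balls :: "'e topology \<Rightarrow> ('e \<Rightarrow> 'a::metric_space) \<Rightarrow> real \<Rightarrow> bool" where
  "sections_over_balls E \<pi> \<delta> \<longleftrightarrow> continuous_map E euclidean \<pi> \<and>
     (\<forall>e\<in>topspace E. \<exists>s. continuous_map (top_of_set (ball (\<pi> e) \<delta>)) E s \<and>
        (\<forall>y\<in>ball (\<pi> e) \<delta>. \<pi> (s y) = y) \<and>
        (\<forall>c. pathin E c \<and> c 0 = e \<and> (\<forall>t\<in>{0..1}. \<pi> (c t) \<in> ball (\<pi> e) \<delta>) \<longrightarrow>
           (\<forall>t\<in>{0..1}. c t = s (\<pi> (c t)))))"

text \<open>The section through the class of \<open>\<gamma>\<close> sends \<open>y\<close> to the class of \<open>\<gamma>\<close> prolonged to \<open>y\<close> inside the ball; by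
  \<open>cover_point_join_local\<close> the choice of the prolongation does not matter. A path projecting into the
  ball cannot leave the sheet over it, as sheets over the ball are open and equal or disjoint.\<close>

lemma sections_over_balls_delta_cover:
  fixes p :: "'a::metric_space"
  assumes geo: "lipschitz_geodesics TYPE('a)" and "\<delta> > 0"
  shows "sections_over_balls (delta_cover p \<delta>) cover_proj \<delta>"
proof -
  define \<U> :: "'a set set" where "\<U> = range (\<lambda>y. ball y \<delta>)"
  have E: "delta_cover p \<delta> = cover_space \<U> p" by (simp add: delta_cover_def \<U>_def)
  have "\<exists>s. continuous_map (top_of_set (ball (cover_proj e) \<delta>)) (cover_space \<U> p) s \<and>
        (\<forall>y\<in>ball (cover_proj e) \<delta>. cover_proj (s y) = y) \<and>
        (\<forall>c. pathin (cover_space \<U> p) c \<and> c 0 = e \<and>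
             (\<forall>t\<in>{0..1}. cover_proj (c t) \<in> ball (cover_proj e) \<delta>) \<longrightarrow>
           (\<forall>t\<in>{0..1}. c t = s (cover_proj (c t))))"
    if top_e: "e \<in> topspace (cover_space \<U> p)" for e
  proof -
    obtain \<gamma> where g: "path_from p \<gamma>" "e = cover_point \<U> p \<gamma>"
      using top_e unfolding topspace_cover_space by blast
    let ?B = "ball (pathfinish \<gamma>) \<delta>"
    have proj_e: "cover_proj e = pathfinish \<gamma>" unfolding g(2) by (rule cover_proj_cover_point[OF g(1)])
    have BU: "?B \<in> \<U>" unfolding \<U>_def by blast
    have "\<forall>y\<in>?B. \<exists>\<eta>. path \<eta> \<and> pathstart \<eta> = pathfinish \<gamma> \<and> pathfinish \<eta> = y \<and> path_image \<eta> \<subseteq> ?B"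
    proof
      fix y assume "y \<in> ?B"
      from path_in_ball[OF geo this]
      show "\<exists>\<eta>. path \<eta> \<and> pathstart \<eta> = pathfinish \<gamma> \<and> pathfinish \<eta> = y \<and> path_image \<eta> \<subseteq> ?B" by blast
    qed
    from bchoice[OF this] obtain h where h: "\<forall>y\<in>?B. path (h y) \<and> pathstart (h y) = pathfinish \<gamma> \<and>
        pathfinish (h y) = y \<and> path_image (h y) \<subseteq> ?B" ..
    note h = h[rule_format]
    define s where "s y = cover_point \<U> p (\<gamma> +++ h y)" for y
    have from_p: "path_from p (\<gamma> +++ h y)" if "y \<in> ?B" for y
      using g h[OF that] by simp
    have s_eq: "cover_point \<U> p (\<gamma> +++ \<eta>) = s (pathfinish \<eta>)"
      if "path \<eta>" "pathstart \<eta> = pathfinish \<gamma>" "path_image \<eta> \<subseteq> ?B" for \<eta>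
    proof -
      have "pathfinish \<eta> \<in> ?B" using that pathfinish_in_path_image by blast
      then show ?thesis
        unfolding s_def using that h g(1) BU by (intro cover_point_join_local[where U = ?B]) simp_all
    qed
    have proj_s: "cover_proj (s y) = y" if "y \<in> ?B" for y
      unfolding s_def using cover_proj_cover_point[OF from_p[OF that]] h[OF that] by simp
    have cont: "continuous_map (top_of_set ?B) (cover_space \<U> p) s"
    proof (rule continuous_map_into_cover_space)
      show "s y \<in> topspace (cover_space \<U> p)" if "y \<in> topspace (top_of_set ?B)" for y
        unfolding topspace_cover_space s_def
        using that from_p[of y] by (intro CollectI exI[of _ "\<gamma> +++ h y"]) simp
      fix y \<gamma>' V
      assume "y \<in> topspace (top_of_set ?B)" and g': "path_from p \<gamma>'" 
        and eq: "s y = cover_point \<U> p \<gamma>'" and V: "open V" "pathfinish \<gamma>' \<in> V"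
      then have y: "y \<in> ?B" by simp
      have fin: "pathfinish \<gamma>' = y"
        using proj_s[OF y] cover_proj_cover_point[OF g', of \<U>] eq by simp
      have "open (V \<inter> ?B)" "y \<in> V \<inter> ?B" using V y fin by auto
      then obtain r where r: "r > 0" "ball y r \<subseteq> V \<inter> ?B" using openE by blast
      have "s z \<in> sheet \<U> p \<gamma>' V" if z: "z \<in> ball y r" for z
      proof -
        obtain \<zeta> where ze: "path \<zeta>" "pathstart \<zeta> = y" "pathfinish \<zeta> = z" "path_image \<zeta> \<subseteq> ball y r"
          using path_in_ball[OF geo z] by blast
        have "path_image (h y +++ \<zeta>) \<subseteq> ?B"
          using path_image_join_subset[of "h y" \<zeta>] h[OF y] ze(4) r(2) by blast
        then have "s z = cover_point \<U> p (\<gamma> +++ (h y +++ \<zeta>))"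
          using s_eq[of "h y +++ \<zeta>"] h[OF y] ze by simp
        also have "\<dots> = cover_point \<U> p ((\<gamma> +++ h y) +++ \<zeta>)"
          using g(1) h[OF y] ze by (intro cover_point_join_assoc) simp_all
        also have "\<dots> = cover_point \<U> p (\<gamma>' +++ \<zeta>)"
          using eq g' from_p[OF y] h[OF y] ze fin unfolding s_def
          by (subst cover_point_join_right) simp_all
        finally show ?thesis
          using ze fin r by (intro sheetI[of \<zeta>]) auto
      qed
      moreover have "openin (top_of_set ?B) (ball y r)"
        using r by (intro open_subset) auto
      ultimately show "\<exists>W. openin (top_of_set ?B) W \<and> y \<in> W \<and> s ` W \<subseteq> sheet \<U> p \<gamma>' V"
        using r by (intro exI[of _ "ball y r"] conjI image_subsetI) simp_all
    qed
    have lift: "c t = s (cover_proj (c t))"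
      if c: "pathin (cover_space \<U> p) c" "c 0 = e" "\<And>t. t \<in> {0..1} \<Longrightarrow> cover_proj (c t) \<in> ?B"
        and t: "t \<in> {0..1}" for c t
    proof -
      have "c t \<in> sheet \<U> p \<gamma> ?B"
      proof (rule connected_induction_simple[of "{0..1::real}" 0 t "\<lambda>t. c t \<in> sheet \<U> p \<gamma> ?B"])
        show "c 0 \<in> sheet \<U> p \<gamma> ?B"
          unfolding c(2) g(2) using g(1) assms(2) by (intro sheet_self) simp_all
        fix a :: real assume a: "a \<in> {0..1}"
        have "c a \<in> topspace (cover_space \<U> p)"
          using path_image_subset_topspace[OF c(1)] a by blast
        then obtain \<gamma>' where g': "path_from p \<gamma>'" "c a = cover_point \<U> p \<gamma>'"
          unfolding topspace_cover_space by blast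
        let ?T = "{u \<in> topspace (top_of_set {0..1}). c u \<in> sheet \<U> p \<gamma>' ?B}"
        have "openin (top_of_set {0..1}) ?T"
          using c(1) openin_sheet[OF g'(1) open_ball]
          unfolding pathin_def continuous_map_def by blast
        moreover have "pathfinish \<gamma>' \<in> ?B"
          using c(3)[OF a] cover_proj_cover_point[OF g'(1), of \<U>] g'(2) by simp
        then have "a \<in> ?T"
          using a g' sheet_self[OF g'(1), of ?B \<U>] by simp
        moreover have "c v \<in> sheet \<U> p \<gamma> ?B" if "u \<in> ?T" "v \<in> ?T" "c u \<in> sheet \<U> p \<gamma> ?B" for u v
        proof -
          have "c u \<in> topspace (cover_space \<U> p)"
            using that(1) funcset_mem[OF path_image_subset_topspace[OF c(1)], of u] by simp
          then obtain \<zeta> where z: "path_from p \<zeta>" "c u = cover_point \<U> p \<zeta>"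
            unfolding topspace_cover_space by blast
          have "sheet \<U> p \<zeta> ?B = sheet \<U> p \<gamma> ?B"
            by (rule sheet_shift[OF g(1) z(1)]) (use that(3) z(2) in simp)
          moreover have "sheet \<U> p \<zeta> ?B = sheet \<U> p \<gamma>' ?B"
            by (rule sheet_shift[OF g'(1) z(1)]) (use that(1) z(2) in simp)
          ultimately have "sheet \<U> p \<gamma>' ?B = sheet \<U> p \<gamma> ?B" by simp
          then show ?thesis using that by simp
        qed
        ultimately show "\<exists>T. openin (top_of_set {0..1}) T \<and> a \<in> T \<and>
            (\<forall>u\<in>T. \<forall>v\<in>T. c u \<in> sheet \<U> p \<gamma> ?B \<longrightarrow> c v \<in> sheet \<U> p \<gamma> ?B)"
          by (intro exI[of _ ?T] conjI ballI impI)
      qed (use t in auto)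
      then obtain \<eta> where e: "path \<eta>" "pathstart \<eta> = pathfinish \<gamma>" "path_image \<eta> \<subseteq> ?B"
        "c t = cover_point \<U> p (\<gamma> +++ \<eta>)" unfolding sheet_def by blast
      then have c_t: "c t = s (pathfinish \<eta>)" using s_eq by simp
      moreover have "pathfinish \<eta> \<in> ?B" using e pathfinish_in_path_image by blast
      ultimately show ?thesis using proj_s by simp
    qed
    show ?thesis unfolding proj_e
    proof (intro exI[of _ s] conjI ballI allI impI cont)
      show "cover_proj (s y) = y" if "y \<in> ?B" for y by (rule proj_s[OF that])
      show "c t = s (cover_proj (c t))"
        if c: "pathin (cover_space \<U> p) c \<and> c 0 = e \<and> (\<forall>t\<in>{0..1}. cover_proj (c t) \<in> ?B)"
          and t: "t \<in> {0..1}" for c t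
        by (rule lift) (use c t in simp_all)
    qed
  qed
  then show ?thesis
    unfolding sections_over_balls_def E by (intro conjI ballI continuous_map_cover_proj)
qed

lemma pathin_segment:
  assumes "pathin E c" "u \<in> {0..1}" "v \<in> {0..1}"
  shows "pathin E (c \<circ> linepath u v)"
proof -
  have "closed_segment u v \<subseteq> {0..1}"
    using assms by (simp add: closed_segment_subset)
  then have "linepath u v ` {0..1} \<subseteq> {0..1}" 
    by (simp add: path_image_linepath flip: path_image_def)
  then have "continuous_map (top_of_set {0..1}) (top_of_set {0..1}) (linepath u v)"
    by (auto simp: continuous_map_in_subtopology continuous_on_linepath image_subset_iff)
  then show ?thesis
    using assms(1) unfolding pathin_def by (rule continuous_map_compose)
qed

lemma continuous_on_projected_path:
  assumes "continuous_map E euclidean \<pi>" "pathin E c"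
  shows "continuous_on {0..1} (\<pi> \<circ> c)"
  using continuous_map_compose[of "top_of_set {0..1}" E c euclidean \<pi>] assms
  by (simp add: pathin_def)

text \<open>Near any parameter the two lifts project into one ball of radius \<open>\<delta> / 2\<close>, hence into the ball of radius \<open>\<delta>\<close>
  around the projection of any nearby point where they agree, and then both lie on the same section. So
  the set where they agree is open and closed in the interval.\<close>

lemma unique_lifting:
  assumes sec: "sections_over_balls E \<pi> \<delta>" and "\<delta> > 0"
    and c: "pathin E c" "pathin E c'" and start: "c 0 = c' 0"
    and same: "\<And>t. t \<in> {0..1} \<Longrightarrow> \<pi> (c t) = \<pi> (c' t)" and t: "t \<in> {0..1}"
  shows "c t = c' t"
proof (rule connected_induction_simple[of "{0..1::real}" 0 t "\<lambda>t. c t = c' t"])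
  fix a :: real assume a: "a \<in> {0..1}"
  let ?\<gamma> = "\<pi> \<circ> c"
  have "continuous_on {0..1} ?\<gamma>"
    by (rule continuous_on_projected_path[OF conjunct1[OF sec[unfolded sections_over_balls_def]] c(1)])
  then obtain d where d: "d > 0" "\<And>u. u \<in> {0..1} \<Longrightarrow> dist u a < d \<Longrightarrow> dist (?\<gamma> u) (?\<gamma> a) < \<delta> / 2"
    unfolding continuous_on_iff using a half_gt_zero[OF \<open>\<delta> > 0\<close>] by blast
  let ?T = "{0..1} \<inter> ball a d"
  have "c v = c' v" if uv: "u \<in> ?T" "v \<in> ?T" and eq: "c u = c' u" for u v
  proof -
    have uv1: "u \<in> {0..1}" "v \<in> {0..1}" using uv by simp_all
    have "c u \<in> topspace E" by (rule funcset_mem[OF path_image_subset_topspace[OF c(1)] uv1(1)])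
    from bspec[OF conjunct2[OF sec[unfolded sections_over_balls_def]] this] obtain s where
      s: "\<forall>b. pathin E b \<and> b 0 = c u \<and> (\<forall>t\<in>{0..1}. \<pi> (b t) \<in> ball (\<pi> (c u)) \<delta>) \<longrightarrow>
        (\<forall>t\<in>{0..1}. b t = s (\<pi> (b t)))" by blast
    have seg: "closed_segment u v \<subseteq> ?T"
      using uv by (intro closed_segment_subset convex_Int) simp_all
    have mem: "linepath u v t \<in> ?T" if "t \<in> {0..1}" for t
      using that linepath_in_path[of t u v] seg by blast
    have near: "?\<gamma> w \<in> ball (\<pi> (c u)) \<delta>" if w: "w \<in> ?T" for w
    proof -
      have "dist (?\<gamma> w) (?\<gamma> a) < \<delta> / 2" "dist (?\<gamma> u) (?\<gamma> a) < \<delta> / 2"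
        using d(2)[of w] d(2)[of u] w uv by (simp_all add: dist_commute)
      then show ?thesis
        using dist_triangle_half_l[of "?\<gamma> w" "?\<gamma> a" \<delta> "?\<gamma> u"]
        by (simp add: dist_commute)
    qed
    have end_at: "b (linepath u v 1) = s (\<pi> (b (linepath u v 1)))"
      if b: "pathin E b" "b u = c u" "\<And>t. t \<in> {0..1} \<Longrightarrow> \<pi> (b t) = ?\<gamma> t" for b
    proof -
      have "\<pi> ((b \<circ> linepath u v) t) \<in> ball (\<pi> (c u)) \<delta>" if t: "t \<in> {0..1}" for t
      proof -
        have m: "linepath u v t \<in> ?T" by (rule mem[OF t])
        then have "\<pi> (b (linepath u v t)) = ?\<gamma> (linepath u v t)" by (intro b(3)) blast
        then show ?thesis using near[OF m] by simp
      qed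
      moreover have "(b \<circ> linepath u v) 0 = c u" using b(2) by (simp add: linepath_0')
      ultimately have "\<forall>t\<in>{0..1}. (b \<circ> linepath u v) t = s (\<pi> ((b \<circ> linepath u v) t))"
        by (intro s[rule_format, OF conjI[OF pathin_segment[OF b(1) uv1]]] ballI) blast
      then show ?thesis by simp
    qed
    have "c v = s (\<pi> (c v))"
      using end_at[OF c(1)] by (simp add: linepath_1')
    moreover have "c' v = s (\<pi> (c' v))"
      using end_at[OF c(2) eq[symmetric]] same by (simp add: linepath_1')
    ultimately show ?thesis using same[OF uv1(2)] by simp
  qed
  moreover have "openin (top_of_set {0..1}) ?T" "a \<in> ?T"
    using a d(1) by (simp_all add: openin_open_Int)
  ultimately show "\<exists>T. openin (top_of_set {0..1}) T \<and> a \<in> T \<and> (\<forall>u\<in>T. \<forall>v\<in>T. c u = c' u \<longrightarrow> c v = c' v)"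
    by (intro exI[of _ ?T] conjI ballI impI)
qed (use t start in auto)

section \<open>Maps of covering spaces induced by maps of the base\<close>

definition cover_rep :: "'a::topological_space set set \<Rightarrow> 'a \<Rightarrow> (real \<Rightarrow> 'a) set \<Rightarrow> real \<Rightarrow> 'a" where
  "cover_rep \<U> p e = (SOME \<gamma>. path_from p \<gamma> \<and> cover_point \<U> p \<gamma> = e)"

lemma cover_rep:
  assumes "path_from p \<gamma>"
  shows "path_from p (cover_rep \<U> p (cover_point \<U> p \<gamma>))"
    and "cover_point \<U> p (cover_rep \<U> p (cover_point \<U> p \<gamma>)) = cover_point \<U> p \<gamma>"
proof -
  have "\<exists>\<gamma>'. path_from p \<gamma>' \<and> cover_point \<U> p \<gamma>' = cover_point \<U> p \<gamma>" using assms by blast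
  from someI_ex[OF this]
  show "path_from p (cover_rep \<U> p (cover_point \<U> p \<gamma>))"
    "cover_point \<U> p (cover_rep \<U> p (cover_point \<U> p \<gamma>)) = cover_point \<U> p \<gamma>"
    unfolding cover_rep_def by blast+
qed

text \<open>The lift of a map \<open>h\<close> of base spaces, sending the class of \<open>\<gamma>\<close> to the class of \<open>h \<circ> \<gamma>\<close>. It is written with
  a chosen representative; \<open>cover_map_cover_point\<close> shows that the choice is immaterial.\<close>

definition cover_map :: "'a::topological_space set set \<Rightarrow> 'a \<Rightarrow> 'b::topological_space set set \<Rightarrow> ('a \<Rightarrow> 'b) \<Rightarrow>
    (real \<Rightarrow> 'a) set \<Rightarrow> (real \<Rightarrow> 'b) set" where
  "cover_map \<U> p \<V> h e = cover_point \<V> (h p) (h \<circ> cover_rep \<U> p e)"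

lemma path_compose_continuous:
  assumes "continuous_on UNIV h" "path \<gamma>"
  shows "path (h \<circ> \<gamma>)"
  using assms by (intro path_continuous_image) (auto intro: continuous_on_subset)

lemma cover_map_cover_point:
  assumes h: "continuous_on UNIV h" and ref: "\<And>U. U \<in> \<U> \<Longrightarrow> \<exists>V\<in>\<V>. h ` U \<subseteq> V"
    and g: "path_from p \<gamma>"
  shows "cover_map \<U> p \<V> h (cover_point \<U> p \<gamma>) = cover_point \<V> (h p) (h \<circ> \<gamma>)"
proof -
  define \<gamma>' where "\<gamma>' = cover_rep \<U> p (cover_point \<U> p \<gamma>)"
  have g': "path_from p \<gamma>'" "cover_point \<U> p \<gamma>' = cover_point \<U> p \<gamma>"
    unfolding \<gamma>'_def by (rule cover_rep[OF g])+
  then have eq: "pathfinish \<gamma>' = pathfinish \<gamma>" "null_loop \<U> p (\<gamma>' +++ reversepath \<gamma>)"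
    using cover_point_eq_iff[OF g'(1) g] by blast+
  have "null_loop \<V> (h p) ((h \<circ> \<gamma>') +++ reversepath (h \<circ> \<gamma>))"
    using null_loop_image[OF h ref eq(2)] by (simp add: path_compose_join path_compose_reversepath)
  moreover have "path_from (h p) (h \<circ> \<gamma>)" "path_from (h p) (h \<circ> \<gamma>')"
    using g g' path_compose_continuous[OF h] by (simp_all add: pathstart_compose)
  ultimately have "cover_point \<V> (h p) (h \<circ> \<gamma>') = cover_point \<V> (h p) (h \<circ> \<gamma>)"
    using eq(1) cover_point_eq_iff[of "h \<circ> \<gamma>'" "h p" "h \<circ> \<gamma>" \<V>] by (simp add: pathfinish_compose)
  then show ?thesis unfolding cover_map_def \<gamma>'_def .
qed

lemma continuous_map_cover_map:
  assumes h: "continuous_on UNIV h" and ref: "\<And>U. U \<in> \<U> \<Longrightarrow> \<exists>V\<in>\<V>. h ` U \<subseteq> V"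
  shows "continuous_map (cover_space \<U> p) (cover_space \<V> (h p)) (cover_map \<U> p \<V> h)"
proof (rule continuous_map_into_cover_space)
  have image: "path_from (h p) (h \<circ> \<gamma>)" if "path_from p \<gamma>" for \<gamma>
    using that path_compose_continuous[OF h] by (simp add: pathstart_compose)
  have cp: "cover_map \<U> p \<V> h (cover_point \<U> p \<gamma>) = cover_point \<V> (h p) (h \<circ> \<gamma>)" if "path_from p \<gamma>" for \<gamma>
    by (rule cover_map_cover_point[OF h ref that])
  show "cover_map \<U> p \<V> h e \<in> topspace (cover_space \<V> (h p))"
    if top_e: "e \<in> topspace (cover_space \<U> p)" for e
  proof -
    obtain \<gamma> where g: "path_from p \<gamma>" "e = cover_point \<U> p \<gamma>"
      using top_e unfolding topspace_cover_space by blast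
    show ?thesis
      unfolding topspace_cover_space g(2) cp[OF g(1)] using image[OF g(1)] by blast
  qed
  fix e \<gamma>' V
  assume top_e: "e \<in> topspace (cover_space \<U> p)" and g': "path_from (h p) \<gamma>'"
    and eq: "cover_map \<U> p \<V> h e = cover_point \<V> (h p) \<gamma>'" and V: "open V" "pathfinish \<gamma>' \<in> V"
  obtain \<gamma> where g: "path_from p \<gamma>" "e = cover_point \<U> p \<gamma>"
    using top_e unfolding topspace_cover_space by blast
  have same: "cover_point \<V> (h p) (h \<circ> \<gamma>) = cover_point \<V> (h p) \<gamma>'"
    using eq unfolding g(2) cp[OF g(1)] .
  then have fin: "pathfinish \<gamma>' = h (pathfinish \<gamma>)"
    using cover_point_eq_iff[OF image[OF g(1)] g', of \<V>] by (simp add: pathfinish_compose)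
  have "cover_map \<U> p \<V> h e' \<in> sheet \<V> (h p) \<gamma>' V" if e': "e' \<in> sheet \<U> p \<gamma> (h -` V)" for e'
  proof -
    obtain \<eta> where e: "path \<eta>" "pathstart \<eta> = pathfinish \<gamma>" "path_image \<eta> \<subseteq> h -` V"
      "e' = cover_point \<U> p (\<gamma> +++ \<eta>)" using e' unfolding sheet_def by blast
    have "path_from p (\<gamma> +++ \<eta>)" using g e by simp
    then have "cover_map \<U> p \<V> h e' = cover_point \<V> (h p) ((h \<circ> \<gamma>) +++ (h \<circ> \<eta>))"
      unfolding e(4) by (subst cp) (simp_all add: path_compose_join)
    also have "\<dots> = cover_point \<V> (h p) (\<gamma>' +++ (h \<circ> \<eta>))"
      using same image[OF g(1)] g' e path_compose_continuous[OF h e(1)] fin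
      by (subst cover_point_join_right) (simp_all add: pathstart_compose pathfinish_compose)
    finally show ?thesis
      using e path_compose_continuous[OF h e(1)] fin
      by (intro sheetI[of "h \<circ> \<eta>"]) (auto simp: pathstart_compose path_image_compose)
  qed
  moreover have "open (h -` V)" using V(1) h by (simp add: open_vimage)
  then have "openin (cover_space \<U> p) (sheet \<U> p \<gamma> (h -` V))" by (intro openin_sheet g(1))
  moreover have "e \<in> sheet \<U> p \<gamma> (h -` V)"
    unfolding g(2) using V(2) fin by (intro sheet_self g(1)) simp
  ultimately show "\<exists>W. openin (cover_space \<U> p) W \<and> e \<in> W \<and> cover_map \<U> p \<V> h ` W \<subseteq> sheet \<V> (h p) \<gamma>' V"
    by (intro exI[of _ "sheet \<U> p \<gamma> (h -` V)"] conjI image_subsetI)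
qed

section \<open>Splitting the covering of a product\<close>

abbreviation balls :: "real \<Rightarrow> 'a::metric_space set set" where
  "balls \<delta> \<equiv> range (\<lambda>y. ball y \<delta>)"

lemma balls_fst: "U \<in> balls \<delta> \<Longrightarrow> \<exists>V\<in>balls \<delta>. fst ` U \<subseteq> V"
  using order.strict_trans1[OF dist_fst_le] by fastforce

lemma balls_snd: "U \<in> balls \<delta> \<Longrightarrow> \<exists>V\<in>balls \<delta>. snd ` U \<subseteq> V"
  using order.strict_trans1[OF dist_snd_le] by fastforce

lemma balls_Pair_left: "U \<in> balls \<delta> \<Longrightarrow> \<exists>V\<in>balls \<delta>. (\<lambda>x. (x, y)) ` U \<subseteq> V"
proof -
  assume "U \<in> balls \<delta>"
  then obtain z where "U = ball z \<delta>" by blast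
  then have "(\<lambda>x. (x, y)) ` U \<subseteq> ball (z, y) \<delta>" by (auto simp: dist_Pair_Pair)
  then show ?thesis by blast
qed

lemma balls_Pair_right: "U \<in> balls \<delta> \<Longrightarrow> \<exists>V\<in>balls \<delta>. (\<lambda>x. (y, x)) ` U \<subseteq> V"
proof -
  assume "U \<in> balls \<delta>"
  then obtain z where "U = ball z \<delta>" by blast
  then have "(\<lambda>x. (y, x)) ` U \<subseteq> ball (y, z) \<delta>" by (auto simp: dist_Pair_Pair)
  then show ?thesis by blast
qed

lemma null_loop_fst: "null_loop (balls \<delta>) p \<gamma> \<Longrightarrow> null_loop (balls \<delta>) (fst p) (fst \<circ> \<gamma>)"
  by (rule null_loop_image[OF _ balls_fst]) (auto intro: continuous_intros)

lemma null_loop_snd: "null_loop (balls \<delta>) p \<gamma> \<Longrightarrow> null_loop (balls \<delta>) (snd p) (snd \<circ> \<gamma>)"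
  by (rule null_loop_image[OF _ balls_snd]) (auto intro: continuous_intros)

lemma null_loop_Pair_left:
  assumes "null_loop (balls \<delta>) x \<gamma>"
  shows "null_loop (balls \<delta>) (x, y) (\<lambda>t. (\<gamma> t, y))"
proof -
  have "null_loop (balls \<delta>) (x, y) ((\<lambda>x. (x, y)) \<circ> \<gamma>)"
    by (rule null_loop_image[OF _ balls_Pair_left assms]) (auto intro: continuous_intros)
  then show ?thesis by (simp add: comp_def)
qed

lemma null_loop_Pair_right:
  assumes "null_loop (balls \<delta>) x \<gamma>"
  shows "null_loop (balls \<delta>) (y, x) (\<lambda>t. (y, \<gamma> t))"
proof -
  have "null_loop (balls \<delta>) (y, x) ((\<lambda>x. (y, x)) \<circ> \<gamma>)"
    by (rule null_loop_image[OF _ balls_Pair_right assms]) (auto intro: continuous_intros)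
  then show ?thesis by (simp add: comp_def)
qed

lemma joinpaths_Pair:
  "(\<lambda>t. (a t, b t)) +++ (\<lambda>t. (a' t, b' t)) = (\<lambda>t. ((a +++ a') t, (b +++ b') t))"
  by (auto simp: joinpaths_def)

text \<open>The algebraic core: the covering subgroup of the product is the product of the covering subgroups.
  The projections and the inclusions of the slices map balls into balls of the same radius, so that they
  preserve null loops; and a loop \<open>(a, b)\<close> is homotopic to \<open>(a, q) +++ (p, b)\<close>.\<close>

lemma null_loop_prod:
  "null_loop (balls \<delta>) (p, q) \<gamma> \<longleftrightarrow>
    null_loop (balls \<delta>) p (fst \<circ> \<gamma>) \<and> null_loop (balls \<delta>) q (snd \<circ> \<gamma>)"
proof
  show "null_loop (balls \<delta>) p (fst \<circ> \<gamma>) \<and> null_loop (balls \<delta>) q (snd \<circ> \<gamma>)"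
    if "null_loop (balls \<delta>) (p, q) \<gamma>"
    using null_loop_fst[OF that] null_loop_snd[OF that] by simp
  assume n: "null_loop (balls \<delta>) p (fst \<circ> \<gamma>) \<and> null_loop (balls \<delta>) q (snd \<circ> \<gamma>)"
  define a b where "a = fst \<circ> \<gamma>" and "b = snd \<circ> \<gamma>"
  have ab: "\<gamma> = (\<lambda>t. (a t, b t))" by (auto simp: a_def b_def)
  have null: "null_loop (balls \<delta>) p a" "null_loop (balls \<delta>) q b" using n unfolding a_def b_def by auto
  note loops = null[THEN null_loop_imp_loop]
  have "null_loop (balls \<delta>) (p, q) ((\<lambda>t. (a t, q)) +++ (\<lambda>t. (p, b t)))"
    by (intro null_loop_join null_loop_Pair_left null_loop_Pair_right null)
  moreover have "homotopic_paths UNIV ((\<lambda>t. (a t, q)) +++ (\<lambda>t. (p, b t))) (\<lambda>t. (a t, b t))"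
    unfolding joinpaths_Pair
    using loops by (intro homotopic_paths_Pair homotopic_paths_const_left homotopic_paths_const_right) simp_all
  ultimately show "null_loop (balls \<delta>) (p, q) \<gamma>"
    unfolding ab using null_loop_homotopic by blast
qed

lemma path_fst: "path \<gamma> \<Longrightarrow> path (fst \<circ> \<gamma>)" and path_snd: "path \<gamma> \<Longrightarrow> path (snd \<circ> \<gamma>)"
  by (auto intro!: path_compose_continuous continuous_intros)

lemma path_from_fst: "path_from (p, q) \<gamma> \<Longrightarrow> path_from p (fst \<circ> \<gamma>)"
  and path_from_snd: "path_from (p, q) \<gamma> \<Longrightarrow> path_from q (snd \<circ> \<gamma>)"
  by (simp_all add: path_fst path_snd pathstart_compose)

lemma path_from_Pair: "path_from p a \<Longrightarrow> path_from q b \<Longrightarrow> path_from (p, q) (\<lambda>t. (a t, b t))"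
  by (auto simp: path_def pathstart_def intro: continuous_on_Pair)

lemma cover_point_prod_eq_iff:
  assumes "path_from (p, q) \<gamma>" "path_from (p, q) \<gamma>'"
  shows "cover_point (balls \<delta>) (p, q) \<gamma> = cover_point (balls \<delta>) (p, q) \<gamma>' \<longleftrightarrow>
    cover_point (balls \<delta>) p (fst \<circ> \<gamma>) = cover_point (balls \<delta>) p (fst \<circ> \<gamma>') \<and>
    cover_point (balls \<delta>) q (snd \<circ> \<gamma>) = cover_point (balls \<delta>) q (snd \<circ> \<gamma>')"
  unfolding cover_point_eq_iff[OF assms] cover_point_eq_iff[OF assms[THEN path_from_fst]]
    cover_point_eq_iff[OF assms[THEN path_from_snd]] null_loop_prod
  by (auto simp: path_compose_join path_compose_reversepath pathfinish_compose prod_eq_iff)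

definition delta_cover_split ::
  "'a::metric_space \<Rightarrow> 'b::metric_space \<Rightarrow> real \<Rightarrow> (real \<Rightarrow> 'a \<times> 'b) set \<Rightarrow> (real \<Rightarrow> 'a) set \<times> (real \<Rightarrow> 'b) set" where
  "delta_cover_split p q \<delta> e =
     (cover_map (balls \<delta>) (p, q) (balls \<delta>) fst e, cover_map (balls \<delta>) (p, q) (balls \<delta>) snd e)"

lemma delta_cover_split_cover_point:
  assumes "path_from (p, q) \<gamma>"
  shows "delta_cover_split p q \<delta> (cover_point (balls \<delta>) (p, q) \<gamma>) =
    (cover_point (balls \<delta>) p (fst \<circ> \<gamma>), cover_point (balls \<delta>) q (snd \<circ> \<gamma>))"
proof -
  have "cover_map (balls \<delta>) (p, q) (balls \<delta>) fst (cover_point (balls \<delta>) (p, q) \<gamma>) =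
      cover_point (balls \<delta>) (fst (p, q)) (fst \<circ> \<gamma>)"
    by (rule cover_map_cover_point[OF continuous_on_fst[OF continuous_on_id] balls_fst assms])
  moreover have "cover_map (balls \<delta>) (p, q) (balls \<delta>) snd (cover_point (balls \<delta>) (p, q) \<gamma>) =
      cover_point (balls \<delta>) (snd (p, q)) (snd \<circ> \<gamma>)"
    by (rule cover_map_cover_point[OF continuous_on_snd[OF continuous_on_id] balls_snd assms])
  ultimately show ?thesis unfolding delta_cover_split_def by simp
qed

lemma topspace_delta_cover: "topspace (delta_cover p \<delta>) = {cover_point (balls \<delta>) p \<gamma> | \<gamma>. path_from p \<gamma>}"
  unfolding delta_cover_def by (rule topspace_cover_space)

text \<open>Pairing of representatives, the inverse of \<open>delta_cover_split\<close>.\<close>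

definition delta_cover_glue ::
  "'a::metric_space \<Rightarrow> 'b::metric_space \<Rightarrow> real \<Rightarrow> (real \<Rightarrow> 'a) set \<times> (real \<Rightarrow> 'b) set \<Rightarrow> (real \<Rightarrow> 'a \<times> 'b) set" where
  "delta_cover_glue p q \<delta> = (\<lambda>(e, e'). cover_point (balls \<delta>) (p, q)
     (\<lambda>t. (cover_rep (balls \<delta>) p e t, cover_rep (balls \<delta>) q e' t)))"

lemma delta_cover_glue_cover_point:
  assumes "path_from p a" "path_from q b"
  shows "delta_cover_glue p q \<delta> (cover_point (balls \<delta>) p a, cover_point (balls \<delta>) q b) =
    cover_point (balls \<delta>) (p, q) (\<lambda>t. (a t, b t))"
proof -
  have "fst \<circ> (\<lambda>t. (c t, d t)) = c" "snd \<circ> (\<lambda>t. (c t, d t)) = d" for c :: "real \<Rightarrow> 'a" and d :: "real \<Rightarrow> 'b"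
    by auto
  then show ?thesis
    unfolding delta_cover_glue_def
    using cover_rep[OF assms(1), of "balls \<delta>"] cover_rep[OF assms(2), of "balls \<delta>"] assms
    by (simp add: cover_point_prod_eq_iff path_from_Pair[simplified])
qed

text \<open>A neighbourhood in the product contains a box, and the pairs of prolongations inside the sides of
  the box are prolongations inside the box.\<close>

lemma continuous_map_delta_cover_glue:
  "continuous_map (prod_topology (delta_cover p \<delta>) (delta_cover q \<delta>)) (delta_cover (p, q) \<delta>)
     (delta_cover_glue p q \<delta>)"
proof -
  let ?P = "prod_topology (delta_cover p \<delta>) (delta_cover q \<delta>)"
  have split: "\<exists>a b. path_from p a \<and> path_from q b \<and> x = (cover_point (balls \<delta>) p a, cover_point (balls \<delta>) q b)"
    if "x \<in> topspace ?P" for x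
    using that unfolding topspace_prod_topology topspace_delta_cover by auto
  have "continuous_map ?P (cover_space (balls \<delta>) (p, q)) (delta_cover_glue p q \<delta>)"
  proof (rule continuous_map_into_cover_space)
    show "delta_cover_glue p q \<delta> x \<in> topspace (cover_space (balls \<delta>) (p, q))"
      if top_x: "x \<in> topspace ?P" for x
    proof -
      obtain a b where ab: "path_from p a" "path_from q b" "x = (cover_point (balls \<delta>) p a, cover_point (balls \<delta>) q b)"
        using split[OF top_x] by blast
      show ?thesis
        unfolding ab(3) delta_cover_glue_cover_point[OF ab(1,2)] topspace_cover_space
        using path_from_Pair[OF ab(1,2)] by blast
    qed
    fix x \<gamma> V
    assume top_x: "x \<in> topspace ?P" and g: "path_from (p, q) \<gamma>"
      and eq: "delta_cover_glue p q \<delta> x = cover_point (balls \<delta>) (p, q) \<gamma>" and V: "open V" "pathfinish \<gamma> \<in> V"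
    obtain a b where ab: "path_from p a" "path_from q b" "x = (cover_point (balls \<delta>) p a, cover_point (balls \<delta>) q b)"
      using split[OF top_x] by blast
    have same: "cover_point (balls \<delta>) (p, q) (\<lambda>t. (a t, b t)) = cover_point (balls \<delta>) (p, q) \<gamma>"
      using eq unfolding ab(3) delta_cover_glue_cover_point[OF ab(1,2)] .
    then have "pathfinish (\<lambda>t. (a t, b t)) = pathfinish \<gamma>"
      using cover_point_eq_iff[OF path_from_Pair[OF ab(1,2)] g] by blast
    then have fin: "pathfinish \<gamma> = (pathfinish a, pathfinish b)" by (simp add: pathfinish_def)
    then obtain A B where AB: "open A" "open B" "pathfinish a \<in> A" "pathfinish b \<in> B" "A \<times> B \<subseteq> V"
      using open_prod_elim[OF V] by (metis mem_Sigma_iff)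
    let ?W = "sheet (balls \<delta>) p a A \<times> sheet (balls \<delta>) q b B"
    have "delta_cover_glue p q \<delta> y \<in> sheet (balls \<delta>) (p, q) \<gamma> V" if y: "y \<in> ?W" for y
    proof -
      obtain \<eta> where e: "path \<eta>" "pathstart \<eta> = pathfinish a" "path_image \<eta> \<subseteq> A"
        "fst y = cover_point (balls \<delta>) p (a +++ \<eta>)"
        using y unfolding sheet_def by auto
      obtain \<zeta> where z: "path \<zeta>" "pathstart \<zeta> = pathfinish b" "path_image \<zeta> \<subseteq> B"
        "snd y = cover_point (balls \<delta>) q (b +++ \<zeta>)"
        using y unfolding sheet_def by auto
      have ez: "path (\<lambda>t. (\<eta> t, \<zeta> t))" "pathstart (\<lambda>t. (\<eta> t, \<zeta> t)) = pathfinish \<gamma>"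
        using path_from_Pair[of \<eta> "pathfinish a" \<zeta> "pathfinish b"] e z fin by auto
      have "y = (cover_point (balls \<delta>) p (a +++ \<eta>), cover_point (balls \<delta>) q (b +++ \<zeta>))"
        using e z by (simp add: prod_eq_iff)
      then have "delta_cover_glue p q \<delta> y = cover_point (balls \<delta>) (p, q) (\<lambda>t. ((a +++ \<eta>) t, (b +++ \<zeta>) t))"
        using ab e z by (simp add: delta_cover_glue_cover_point)
      also have "\<dots> = cover_point (balls \<delta>) (p, q) ((\<lambda>t. (a t, b t)) +++ (\<lambda>t. (\<eta> t, \<zeta> t)))"
        by (simp add: joinpaths_Pair)
      also have "\<dots> = cover_point (balls \<delta>) (p, q) (\<gamma> +++ (\<lambda>t. (\<eta> t, \<zeta> t)))"
        using same g path_from_Pair[OF ab(1,2)] ez \<open>pathfinish (\<lambda>t. (a t, b t)) = pathfinish \<gamma>\<close>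
        by (subst cover_point_join_right) simp_all
      finally have "delta_cover_glue p q \<delta> y = cover_point (balls \<delta>) (p, q) (\<gamma> +++ (\<lambda>t. (\<eta> t, \<zeta> t)))" .
      moreover have "path_image (\<lambda>t. (\<eta> t, \<zeta> t)) \<subseteq> V"
        using AB(5) e(3) z(3) unfolding path_image_def by blast
      ultimately show ?thesis using ez by (intro sheetI[of "\<lambda>t. (\<eta> t, \<zeta> t)"])
    qed
    moreover have "openin ?P ?W"
      unfolding delta_cover_def
      using ab AB by (simp add: openin_prod_Times_iff openin_sheet)
    moreover have "x \<in> ?W"
      unfolding ab(3) using sheet_self[OF ab(1) AB(3)] sheet_self[OF ab(2) AB(4)] by blast
    ultimately show "\<exists>W. openin ?P W \<and> x \<in> W \<and> delta_cover_glue p q \<delta> ` W \<subseteq> sheet (balls \<delta>) (p, q) \<gamma> V"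
      by (intro exI[of _ ?W] conjI image_subsetI)
  qed
  then show ?thesis by (simp add: delta_cover_def)
qed

lemma continuous_map_delta_cover_split:
  "continuous_map (delta_cover (p, q) \<delta>) (prod_topology (delta_cover p \<delta>) (delta_cover q \<delta>))
     (delta_cover_split p q \<delta>)"
proof -
  have "continuous_map (cover_space (balls \<delta>) (p, q)) (cover_space (balls \<delta>) (fst (p, q)))
      (cover_map (balls \<delta>) (p, q) (balls \<delta>) fst)"
    by (rule continuous_map_cover_map[OF continuous_on_fst[OF continuous_on_id] balls_fst])
  moreover have "continuous_map (cover_space (balls \<delta>) (p, q)) (cover_space (balls \<delta>) (snd (p, q)))
      (cover_map (balls \<delta>) (p, q) (balls \<delta>) snd)"
    by (rule continuous_map_cover_map[OF continuous_on_snd[OF continuous_on_id] balls_snd])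
  ultimately show ?thesis
    unfolding delta_cover_def delta_cover_split_def by (intro continuous_map_pairedI) simp_all
qed

text \<open>Splitting and gluing are inverse to each other on classes because the components of a path determine
  it; \<open>null_loop_prod\<close> enters in that both maps are well defined.\<close>

lemma cover_isomorphism_delta_cover_split:
  "cover_isomorphism (delta_cover (p, q) \<delta>) cover_proj
     (prod_topology (delta_cover p \<delta>) (delta_cover q \<delta>)) (map_prod cover_proj cover_proj)
     (delta_cover_split p q \<delta>)"
  (is "cover_isomorphism ?E _ ?P _ ?f")
  unfolding cover_isomorphism_def
proof
  have "homeomorphic_maps ?E ?P ?f (delta_cover_glue p q \<delta>)"
    unfolding homeomorphic_maps_def
  proof (intro conjI ballI continuous_map_delta_cover_split continuous_map_delta_cover_glue)
    fix e assume "e \<in> topspace ?E"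
    then obtain \<gamma> where g: "path_from (p, q) \<gamma>" "e = cover_point (balls \<delta>) (p, q) \<gamma>"
      unfolding topspace_delta_cover by blast
    show "delta_cover_glue p q \<delta> (?f e) = e"
      unfolding g(2) delta_cover_split_cover_point[OF g(1)]
        delta_cover_glue_cover_point[OF path_from_fst[OF g(1)] path_from_snd[OF g(1)]]
      by simp
  next
    fix x assume "x \<in> topspace ?P"
    then obtain a b where ab: "path_from p a" "path_from q b" 
      "x = (cover_point (balls \<delta>) p a, cover_point (balls \<delta>) q b)"
      unfolding topspace_prod_topology topspace_delta_cover by auto
    show "?f (delta_cover_glue p q \<delta> x) = x"
      unfolding ab(3) delta_cover_glue_cover_point[OF ab(1,2)]
        delta_cover_split_cover_point[OF path_from_Pair[OF ab(1,2)]]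
      by (simp add: comp_def)
  qed
  then show "homeomorphic_map ?E ?P ?f" by (rule homeomorphic_maps_imp_map)
  show "\<forall>e\<in>topspace ?E. map_prod cover_proj cover_proj (?f e) = cover_proj e"
  proof
    fix e assume "e \<in> topspace ?E"
    then obtain \<gamma> where g: "path_from (p, q) \<gamma>" "e = cover_point (balls \<delta>) (p, q) \<gamma>"
      unfolding topspace_delta_cover by blast
    show "map_prod cover_proj cover_proj (?f e) = cover_proj e"
      unfolding g(2) delta_cover_split_cover_point[OF g(1)] cover_proj_cover_point[OF g(1)] map_prod_simp
        cover_proj_cover_point[OF path_from_fst[OF g(1)]] cover_proj_cover_point[OF path_from_snd[OF g(1)]]
      by (simp add: pathfinish_compose)
  qed
qed

section \<open>The lifted length metric through Lipschitz curves\<close>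

text \<open>The point \<open>e'\<close> can be reached from \<open>e\<close> by a curve whose projection is 1-Lipschitz on an interval of
  length \<open>l\<close>. If the base has geodesics, the cover is path connected and has sections over balls, then the
  lifted distance is the infimum of these \<open>l\<close>: see \<open>lifted_dist_le_reach\<close> and \<open>lifted_dist_less_imp_reach\<close>.
  Such curves make it unnecessary to parametrise arbitrary rectifiable curves by arc length. Letting the
  parameter interval vary makes concatenation a mere juxtaposition.\<close>

definition reach :: "'e topology \<Rightarrow> ('e \<Rightarrow> 'a::metric_space) \<Rightarrow> real \<Rightarrow> 'e \<Rightarrow> 'e \<Rightarrow> bool" where
  "reach E \<pi> l e e' \<longleftrightarrow> 0 \<le> l \<and>
     (\<exists>c. continuous_map (top_of_set {0..l}) E c \<and> c 0 = e \<and> c l = e' \<and>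
        (\<forall>s\<in>{0..l}. \<forall>t\<in>{0..l}. dist (\<pi> (c s)) (\<pi> (c t)) \<le> \<bar>s - t\<bar>))"

lemma reach_refl:
  assumes "e \<in> topspace E" "0 \<le> l"
  shows "reach E \<pi> l e e"
  unfolding reach_def using assms by (intro conjI exI[of _ "\<lambda>_. e"]) simp_all

lemma reach_join:
  assumes "reach E \<pi> l e e'" "reach E \<pi> m e' e''"
  shows "reach E \<pi> (l + m) e e''"
proof -
  have lm: "0 \<le> l" "0 \<le> m" using assms by (simp_all add: reach_def)
  obtain c where c: "continuous_map (top_of_set {0..l}) E c" "c 0 = e" "c l = e'"
    "\<And>s t. s \<in> {0..l} \<Longrightarrow> t \<in> {0..l} \<Longrightarrow> dist (\<pi> (c s)) (\<pi> (c t)) \<le> \<bar>s - t\<bar>"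
    using assms(1) unfolding reach_def by blast
  obtain d where d: "continuous_map (top_of_set {0..m}) E d" "d 0 = e'" "d m = e''"
    "\<And>s t. s \<in> {0..m} \<Longrightarrow> t \<in> {0..m} \<Longrightarrow> dist (\<pi> (d s)) (\<pi> (d t)) \<le> \<bar>s - t\<bar>"
    using assms(2) unfolding reach_def by blast
  define b where "b t = (if t \<le> l then c t else d (t - l))" for t
  have cont: "continuous_map (top_of_set {0..l + m}) E b"
    unfolding b_def
  proof (rule continuous_map_cases_le)
    show "continuous_map (top_of_set {0..l + m}) euclideanreal (\<lambda>t. t)"
      "continuous_map (top_of_set {0..l + m}) euclideanreal (\<lambda>t. l)"
      by (simp_all add: continuous_on_id)
    have "subtopology (top_of_set {0..l + m}) {t \<in> topspace (top_of_set {0..l + m}). t \<le> l} = top_of_set {0..l}"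
      unfolding subtopology_subtopology using lm by (intro arg_cong2[of _ _ _ _ subtopology]) auto
    then show "continuous_map (subtopology (top_of_set {0..l + m}) {t \<in> topspace (top_of_set {0..l + m}). t \<le> l}) E c"
      using c(1) by simp
    have "continuous_map (top_of_set {l..l + m}) (top_of_set {0..m}) (\<lambda>t. t - l)"
      by (auto simp: continuous_map_in_subtopology intro!: continuous_intros)
    from continuous_map_compose[OF this d(1)]
    have "continuous_map (top_of_set {l..l + m}) E (\<lambda>t. d (t - l))" by (simp add: comp_def)
    moreover have "subtopology (top_of_set {0..l + m}) {t \<in> topspace (top_of_set {0..l + m}). l \<le> t} = top_of_set {l..l + m}"
      unfolding subtopology_subtopology using lm by (intro arg_cong2[of _ _ _ _ subtopology]) auto
    ultimately show "continuous_map (subtopology (top_of_set {0..l + m}) {t \<in> topspace (top_of_set {0..l + m}). l \<le> t}) E (\<lambda>t. d (t - l))"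
      by simp
    show "c t = d (t - l)" if "t = l" for t using that c d by simp
  qed
  have le: "dist (\<pi> (b s)) (\<pi> (b t)) \<le> \<bar>s - t\<bar>" if st: "s \<in> {0..l + m}" "t \<in> {0..l + m}" "s \<le> t" for s t
  proof (cases "s \<le> l \<and> \<not> t \<le> l")
    case True
    have "dist (\<pi> (b s)) (\<pi> (b t)) \<le> dist (\<pi> (c s)) (\<pi> (c l)) + dist (\<pi> (d 0)) (\<pi> (d (t - l)))"
      using True c(3) d(2) dist_triangle by (simp add: b_def)
    also have "\<dots> \<le> \<bar>s - l\<bar> + \<bar>0 - (t - l)\<bar>"
      using True st lm by (intro add_mono c(4) d(4)) auto
    also have "\<dots> = \<bar>s - t\<bar>" using True by simp
    finally show ?thesis .
  next
    case False
    show ?thesis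
    proof (cases "t \<le> l")
      case True
      then show ?thesis using st c(4)[of s t] by (simp add: b_def)
    next
      case f: False
      then show ?thesis using st False d(4)[of "s - l" "t - l"] by (simp add: b_def)
    qed
  qed
  have "dist (\<pi> (b s)) (\<pi> (b t)) \<le> \<bar>s - t\<bar>" if "s \<in> {0..l + m}" "t \<in> {0..l + m}" for s t
    using le[of s t] le[of t s] that by (cases "s \<le> t") (simp_all add: dist_commute abs_minus_commute)
  moreover have "b 0 = e" using lm c(2) by (simp add: b_def)
  moreover have "b (l + m) = e''" using lm c(3) d(2,3) by (cases "m = 0") (simp_all add: b_def)
  ultimately show ?thesis
    unfolding reach_def using cont lm by (intro conjI exI[of _ b]) simp_all
qed

lemma reach_mono:
  assumes "reach E \<pi> l e e'" "l \<le> m" "e' \<in> topspace E"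
  shows "reach E \<pi> m e e'"
  using reach_join[OF assms(1) reach_refl[OF assms(3), of "m - l"]] assms(2) by simp

text \<open>A path over a ball may be replaced by the geodesic between its ends, lifted along the section: by
  \<open>sections_over_balls\<close> the end point upstairs stays the same.\<close>

lemma reach_local:
  fixes \<pi> :: "'e \<Rightarrow> 'a::metric_space"
  assumes geo: "lipschitz_geodesics TYPE('a)" and sec: "sections_over_balls E \<pi> \<delta>"
    and c: "pathin E c" and near: "\<And>t. t \<in> {0..1} \<Longrightarrow> \<pi> (c t) \<in> ball (\<pi> (c 0)) \<delta>"
  shows "reach E \<pi> (dist (\<pi> (c 0)) (\<pi> (c 1))) (c 0) (c 1)"
proof -
  let ?x = "\<pi> (c 0)" and ?y = "\<pi> (c 1)"
  let ?D = "dist ?x ?y"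
  have ends: "c 0 \<in> topspace E" "c 1 \<in> topspace E"
    by (rule path_start_in_topspace[OF c], rule path_finish_in_topspace[OF c])
  from bspec[OF conjunct2[OF sec[unfolded sections_over_balls_def]] ends(1)]
  obtain s where s: "continuous_map (top_of_set (ball ?x \<delta>)) E s" "\<And>y. y \<in> ball ?x \<delta> \<Longrightarrow> \<pi> (s y) = y"
    and lift: "\<forall>t\<in>{0..1}. c t = s (\<pi> (c t))"
    using c near by blast
  have c01: "c 0 = s ?x" "c 1 = s ?y" using lift by simp_all
  show ?thesis
  proof (cases "?D = 0")
    case True
    then have "c 1 = c 0" using c01 by simp
    then show ?thesis using reach_refl[OF ends(1), of 0 \<pi>] by simp
  next
    case False
    then have D: "?D > 0" by simp
    obtain \<sigma> where sg: "\<sigma> 0 = ?x" "\<sigma> 1 = ?y"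
      "\<And>s t. s \<in> {0..1} \<Longrightarrow> t \<in> {0..1} \<Longrightarrow> dist (\<sigma> s) (\<sigma> t) \<le> ?D * \<bar>s - t\<bar>"
      using geo unfolding lipschitz_geodesics_def by metis
    define \<tau> where "\<tau> t = \<sigma> (t / ?D)" for t
    have tau: "dist (\<tau> u) (\<tau> t) \<le> \<bar>u - t\<bar>" if "u \<in> {0..?D}" "t \<in> {0..?D}" for u t
    proof -
      have "dist (\<tau> u) (\<tau> t) \<le> ?D * \<bar>u / ?D - t / ?D\<bar>"
        unfolding \<tau>_def using that D by (intro sg(3)) auto
      also have "\<dots> = \<bar>?D * (u / ?D - t / ?D)\<bar>" using D by (simp only: abs_mult abs_of_pos)
      also have "\<dots> = \<bar>u - t\<bar>" using D by (simp add: right_diff_distrib)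
      finally show ?thesis .
    qed
    have ball: "\<tau> t \<in> ball ?x \<delta>" if "t \<in> {0..?D}" for t
    proof -
      have "dist ?x (\<tau> t) \<le> t" using tau[of 0 t] that D sg(1) by (simp add: \<tau>_def)
      also have "\<dots> \<le> ?D" using that by simp
      also have "\<dots> < \<delta>" using near[of 1] by simp
      finally show ?thesis by simp
    qed
    have "continuous_on {0..?D} \<tau>"
      by (rule lipschitz_on_continuous_on[of 1], rule lipschitz_onI)
        (use tau in \<open>auto simp: dist_real_def\<close>)
    then have "continuous_map (top_of_set {0..?D}) (top_of_set (ball ?x \<delta>)) \<tau>"
      using ball by (auto simp: continuous_map_in_subtopology)
    from continuous_map_compose[OF this s(1)]
    have cont: "continuous_map (top_of_set {0..?D}) E (s \<circ> \<tau>)" .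
    moreover have "\<pi> ((s \<circ> \<tau>) t) = \<tau> t" if "t \<in> {0..?D}" for t using s(2)[OF ball[OF that]] by simp
    ultimately show ?thesis
      unfolding reach_def using tau c01 sg D
      by (intro conjI exI[of _ "s \<circ> \<tau>"]) (simp_all add: \<tau>_def)
  qed
qed

text \<open>A sufficiently fine inscribed polygon of the projection can be lifted with the same end points. The
  statement is needed for all large \<open>n\<close> so that one subdivision serves both factors of a product.\<close>

lemma reach_polygon:
  fixes \<pi> :: "'e \<Rightarrow> 'a::metric_space"
  assumes geo: "lipschitz_geodesics TYPE('a)" and sec: "sections_over_balls E \<pi> \<delta>" and "\<delta> > 0"
    and c: "pathin E c"
  shows "\<exists>N>0. \<forall>n\<ge>N. reach E \<pi>
    (\<Sum>i<n. dist (\<pi> (c (real i / real n))) (\<pi> (c (real (Suc i) / real n)))) (c 0) (c 1)"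
proof -
  have "continuous_on {0..1} (\<pi> \<circ> c)"
    by (rule continuous_on_projected_path[OF conjunct1[OF sec[unfolded sections_over_balls_def]] c])
  then have "uniformly_continuous_on {0..1} (\<pi> \<circ> c)"
    by (rule compact_uniformly_continuous) simp
  then obtain d where d: "d > 0" "\<And>s t. s \<in> {0..1} \<Longrightarrow> t \<in> {0..1} \<Longrightarrow> dist t s < d \<Longrightarrow> dist (\<pi> (c t)) (\<pi> (c s)) < \<delta>"
    using \<open>\<delta> > 0\<close> unfolding uniformly_continuous_on_def comp_def by blast
  obtain N where N: "N > 0" "inverse (real N) < d"
    using reals_Archimedean[OF d(1)] zero_less_Suc by blast
  have "reach E \<pi> (\<Sum>i<k. dist (\<pi> (c (real i / real n))) (\<pi> (c (real (Suc i) / real n)))) (c 0) (c (real k / real n))"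
    if n: "n \<ge> N" and "k \<le> n" for n k
    using \<open>k \<le> n\<close>
  proof (induction k)
    case 0
    show ?case using reach_refl[OF path_start_in_topspace[OF c], of 0 \<pi>] by simp
  next
    case (Suc k)
    have npos: "real n > 0" using n N(1) by simp
    let ?u = "real k / real n" and ?v = "real (Suc k) / real n"
    have uv: "?u \<in> {0..1}" "?v \<in> {0..1}" using Suc.prems npos by (auto simp: divide_le_eq)
    have len: "?v - ?u < d"
    proof -
      have "?v - ?u = inverse (real n)" using npos by (simp add: field_simps)
      also have "\<dots> \<le> inverse (real N)" using n N(1) by (intro le_imp_inverse_le) simp_all
      finally show ?thesis using N(2) by simp
    qed
    have "?u \<le> ?v" using npos by (intro divide_right_mono) simp_all
    let ?b = "c \<circ> linepath ?u ?v"
    have "reach E \<pi> (dist (\<pi> (?b 0)) (\<pi> (?b 1))) (?b 0) (?b 1)"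
    proof (rule reach_local[OF geo sec pathin_segment[OF c uv]])
      fix t :: real assume t: "t \<in> {0..1}"
      have seg: "linepath ?u ?v t \<in> closed_segment ?u ?v" using t by (intro linepath_in_path)
      then have iv: "linepath ?u ?v t \<in> {?u..?v}" using \<open>?u \<le> ?v\<close> by (simp only: closed_segment_eq_real_ivl if_True)
      have "dist (\<pi> (c ?u)) (\<pi> (c (linepath ?u ?v t))) < \<delta>"
      proof (rule d(2))
        show "linepath ?u ?v t \<in> {0..1}" using iv uv by (meson atLeastAtMost_iff order_trans)
        show "?u \<in> {0..1}" by (rule uv)
        have "\<bar>?u - linepath ?u ?v t\<bar> \<le> ?v - ?u" using iv by (simp only: atLeastAtMost_iff) linarith
        then show "dist ?u (linepath ?u ?v t) < d" using len by (simp only: dist_real_def)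
      qed
      then show "\<pi> (?b t) \<in> ball (\<pi> (?b 0)) \<delta>" by (simp add: linepath_0')
    qed
    then have "reach E \<pi> (dist (\<pi> (c ?u)) (\<pi> (c ?v))) (c ?u) (c ?v)"
      by (simp only: comp_apply linepath_0' linepath_1')
    from reach_join[OF Suc.IH this] Suc.prems show ?case by simp
  qed
  from this[OF _ order_refl] show ?thesis using N(1) by (intro exI[of _ N]) auto
qed

lemma curve_length_lipschitz:
  assumes "\<And>s t. s \<in> {0..1} \<Longrightarrow> t \<in> {0..1} \<Longrightarrow> dist (\<gamma> s) (\<gamma> t) \<le> L * \<bar>s - t\<bar>"
  shows "curve_length \<gamma> \<le> ennreal L"
  unfolding curve_length_def
proof (rule SUP_least, clarify)
  fix n and t :: "nat \<Rightarrow> real"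
  assume t: "t 0 = 0" "t n = 1" "\<forall>i<n. t i \<le> t (Suc i)"
  have lo: "0 \<le> t i" if "i \<le> n" for i
    using that by (induction i) (use t in \<open>auto intro: order_trans\<close>)
  have hi: "t i \<le> 1" if "i \<le> n" for i
    using that by (induction i rule: inc_induct) (use t in \<open>auto intro: order_trans\<close>)
  have "(\<Sum>i<n. ennreal (dist (\<gamma> (t i)) (\<gamma> (t (Suc i))))) = ennreal (\<Sum>i<n. dist (\<gamma> (t i)) (\<gamma> (t (Suc i))))"
    by (simp add: sum_ennreal)
  also have "(\<Sum>i<n. dist (\<gamma> (t i)) (\<gamma> (t (Suc i)))) \<le> (\<Sum>i<n. L * (t (Suc i) - t i))"
  proof (rule sum_mono)
    fix i assume "i \<in> {..<n}"
    then show "dist (\<gamma> (t i)) (\<gamma> (t (Suc i))) \<le> L * (t (Suc i) - t i)"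
      using assms[of "t i" "t (Suc i)"] lo[of i] lo[of "Suc i"] hi[of i] hi[of "Suc i"] t(3) by simp
  qed
  also have "\<dots> = L"
    using t(1,2) by (simp add: sum_distrib_left[symmetric] sum_lessThan_telescope)
  finally show "(\<Sum>i<n. ennreal (dist (\<gamma> (t i)) (\<gamma> (t (Suc i))))) \<le> ennreal L" by (simp add: ennreal_leI)
qed

text \<open>The first inequality records that the infimum is finite, which \<open>enn2real\<close> conceals in the second.\<close>

lemma lifted_dist_le_reach:
  assumes "reach E \<pi> l e e'"
  shows "(INF c \<in> {c. pathin E c \<and> c 0 = e \<and> c 1 = e'}. curve_length (\<pi> \<circ> c)) \<le> ennreal l"
    and "lifted_dist E \<pi> e e' \<le> l"
proof -
  obtain c where l: "0 \<le> l" and c: "continuous_map (top_of_set {0..l}) E c" "c 0 = e" "c l = e'"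
    "\<And>s t. s \<in> {0..l} \<Longrightarrow> t \<in> {0..l} \<Longrightarrow> dist (\<pi> (c s)) (\<pi> (c t)) \<le> \<bar>s - t\<bar>"
    using assms unfolding reach_def by blast
  let ?b = "c \<circ> (\<lambda>t. l * t)"
  have in_l: "l * t \<in> {0..l}" if "t \<in> {0..1}" for t using that l mult_left_mono[of t 1 l] by simp
  have "continuous_map (top_of_set {0..1}) (top_of_set {0..l}) (\<lambda>t. l * t)"
    using in_l by (auto simp: continuous_map_in_subtopology intro!: continuous_intros)
  then have "pathin E ?b" unfolding pathin_def using c(1) by (rule continuous_map_compose)
  then have "?b \<in> {c. pathin E c \<and> c 0 = e \<and> c 1 = e'}" using c by simp
  moreover have "curve_length (\<pi> \<circ> ?b) \<le> ennreal l"
  proof (rule curve_length_lipschitz)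
    fix s t :: real assume st: "s \<in> {0..1}" "t \<in> {0..1}"
    have "\<bar>l * s - l * t\<bar> = l * \<bar>s - t\<bar>" using l by (simp add: abs_mult flip: right_diff_distrib)
    then show "dist ((\<pi> \<circ> ?b) s) ((\<pi> \<circ> ?b) t) \<le> l * \<bar>s - t\<bar>"
      using c(4)[OF in_l[OF st(1)] in_l[OF st(2)]] by simp
  qed
  ultimately show inf: "(INF c \<in> {c. pathin E c \<and> c 0 = e \<and> c 1 = e'}. curve_length (\<pi> \<circ> c)) \<le> ennreal l"
    by (intro INF_lower2[of ?b]) simp_all
  show "lifted_dist E \<pi> e e' \<le> l"
    unfolding lifted_dist_def using enn2real_mono[OF inf] l by simp
qed

lemma lifted_dist_nonneg: "0 \<le> lifted_dist E \<pi> e e'"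
  by (simp add: lifted_dist_def)

text \<open>That \<open>e'\<close> can be reached from \<open>e\<close> excludes an infinite infimum, for which \<open>lifted_dist\<close> would be \<open>0\<close>.\<close>

lemma lifted_dist_less_imp_path:
  assumes "reach E \<pi> m e e'" "lifted_dist E \<pi> e e' < l"
  obtains c where "pathin E c" "c 0 = e" "c 1 = e'" "curve_length (\<pi> \<circ> c) < ennreal l"
proof -
  let ?I = "INF c \<in> {c. pathin E c \<and> c 0 = e \<and> c 1 = e'}. curve_length (\<pi> \<circ> c)"
  have "?I = ennreal (lifted_dist E \<pi> e e')"
    unfolding lifted_dist_def
    by (rule ennreal_enn2real[symmetric], rule le_less_trans[OF lifted_dist_le_reach(1)[OF assms(1)] ennreal_less_top])
  also have "\<dots> < ennreal l"
    by (rule ennreal_lessI[OF le_less_trans[OF lifted_dist_nonneg assms(2)] assms(2)])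
  finally show thesis using that unfolding INF_less_iff by blast
qed

lemma polygon_le_curve_length:
  assumes "n > 0" "curve_length \<gamma> < ennreal l"
  shows "(\<Sum>i<n. dist (\<gamma> (real i / real n)) (\<gamma> (real (Suc i) / real n))) < l"
proof -
  have "(\<Sum>i<n. ennreal (dist (\<gamma> (real i / real n)) (\<gamma> (real (Suc i) / real n)))) \<le> curve_length \<gamma>"
    using assms(1) by (intro curve_length_ge_polygon) (simp_all add: divide_right_mono)
  also have "\<dots> < ennreal l" by (rule assms)
  finally have "ennreal (\<Sum>i<n. dist (\<gamma> (real i / real n)) (\<gamma> (real (Suc i) / real n))) < ennreal l"
    by (simp add: sum_ennreal)
  then show ?thesis by (simp add: ennreal_less_iff sum_nonneg)
qed

text \<open>A nearly shortest path need not be Lipschitz, but the lifted inscribed polygons are, and they are no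
  longer.\<close>

lemma lifted_dist_less_imp_reach:
  fixes \<pi> :: "'e \<Rightarrow> 'a::metric_space"
  assumes geo: "lipschitz_geodesics TYPE('a)" and sec: "sections_over_balls E \<pi> \<delta>" and "\<delta> > 0"
    and "reach E \<pi> m e e'" "lifted_dist E \<pi> e e' < l"
  shows "reach E \<pi> l e e'"
proof -
  obtain c where c: "pathin E c" "c 0 = e" "c 1 = e'" "curve_length (\<pi> \<circ> c) < ennreal l"
    using lifted_dist_less_imp_path[OF assms(4,5)] by blast
  obtain N where N: "N > 0" "\<And>n. n \<ge> N \<Longrightarrow> reach E \<pi>
    (\<Sum>i<n. dist (\<pi> (c (real i / real n))) (\<pi> (c (real (Suc i) / real n)))) (c 0) (c 1)"
    using reach_polygon[OF geo sec \<open>\<delta> > 0\<close> c(1)] by blast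
  have "(\<Sum>i<N. dist (\<pi> (c (real i / real N))) (\<pi> (c (real (Suc i) / real N)))) < l"
    using polygon_le_curve_length[OF N(1) c(4)] by simp
  from less_imp_le[OF this] show ?thesis
    using reach_mono[OF N(2)[OF order_refl]] path_finish_in_topspace[OF c(1)] c(2,3) by simp
qed

lemma path_connected_imp_reach:
  fixes \<pi> :: "'e \<Rightarrow> 'a::metric_space"
  assumes geo: "lipschitz_geodesics TYPE('a)" and sec: "sections_over_balls E \<pi> \<delta>" and "\<delta> > 0"
    and "path_connected_space E" "e \<in> topspace E" "e' \<in> topspace E"
  obtains m where "reach E \<pi> m e e'"
proof -
  obtain c where "pathin E c" "c 0 = e" "c 1 = e'"
    using assms(4-6) unfolding path_connected_space_def by blast
  then show thesis using reach_polygon[OF geo sec \<open>\<delta> > 0\<close>, of c] that by blast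
qed

section \<open>The lifted length metric of a product\<close>

text \<open>Minkowski's inequality for sums of vectors in the plane: a polygon in a product is at least as long
  as the hypotenuse over the lengths of its projections.\<close>

lemma sqrt_sum_squares_sum_le:
  fixes a b :: "nat \<Rightarrow> real"
  shows "sqrt ((\<Sum>i<n. a i)\<^sup>2 + (\<Sum>i<n. b i)\<^sup>2) \<le> (\<Sum>i<n. sqrt ((a i)\<^sup>2 + (b i)\<^sup>2))"
proof (induction n)
  case (Suc n)
  have "sqrt ((\<Sum>i<Suc n. a i)\<^sup>2 + (\<Sum>i<Suc n. b i)\<^sup>2)
      \<le> sqrt ((\<Sum>i<n. a i)\<^sup>2 + (\<Sum>i<n. b i)\<^sup>2) + sqrt ((a n)\<^sup>2 + (b n)\<^sup>2)"
    using real_sqrt_sum_squares_triangle_ineq[of "\<Sum>i<n. a i" "a n" "\<Sum>i<n. b i" "b n"] by simp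
  then show ?case using Suc.IH by simp
qed simp

text \<open>Both curves are run through in the same time \<open>sqrt (l\<^sup>2 + m\<^sup>2)\<close>, that is with constant speeds whose squares
  add up to one.\<close>

lemma reach_prod:
  assumes g: "continuous_map (prod_topology E1 E2) E g"
    and proj: "\<And>x. x \<in> topspace (prod_topology E1 E2) \<Longrightarrow> \<pi> (g x) = (\<pi>1 (fst x), \<pi>2 (snd x))"
    and "reach E1 \<pi>1 l x x'" "reach E2 \<pi>2 m y y'" "l > 0"
  shows "reach E \<pi> (sqrt (l\<^sup>2 + m\<^sup>2)) (g (x, y)) (g (x', y'))"
proof -
  define k where "k = sqrt (l\<^sup>2 + m\<^sup>2)"
  have k: "k > 0" unfolding k_def using \<open>l > 0\<close> by (simp add: add_pos_nonneg)
  have m: "0 \<le> m" using assms(4) by (simp add: reach_def)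
  obtain c where c: "continuous_map (top_of_set {0..l}) E1 c" "c 0 = x" "c l = x'"
    "\<And>s t. s \<in> {0..l} \<Longrightarrow> t \<in> {0..l} \<Longrightarrow> dist (\<pi>1 (c s)) (\<pi>1 (c t)) \<le> \<bar>s - t\<bar>"
    using assms(3) unfolding reach_def by blast
  obtain d where d: "continuous_map (top_of_set {0..m}) E2 d" "d 0 = y" "d m = y'"
    "\<And>s t. s \<in> {0..m} \<Longrightarrow> t \<in> {0..m} \<Longrightarrow> dist (\<pi>2 (d s)) (\<pi>2 (d t)) \<le> \<bar>s - t\<bar>"
    using assms(4) unfolding reach_def by blast
  have scale: "r * (t / k) \<in> {0..r}" if "0 \<le> r" "t \<in> {0..k}" for r t
    using that k mult_left_mono[of "t / k" 1 r] by simp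
  have cont_scale: "continuous_map (top_of_set {0..k}) (top_of_set {0..r}) (\<lambda>t. r * (t / k))" if "0 \<le> r" for r
    using scale[OF that] k by (auto simp: continuous_map_in_subtopology intro!: continuous_intros)
  let ?p = "\<lambda>t. (c (l * (t / k)), d (m * (t / k)))"
  have p: "continuous_map (top_of_set {0..k}) (prod_topology E1 E2) ?p"
    using continuous_map_compose[OF cont_scale c(1)] continuous_map_compose[OF cont_scale d(1)] \<open>l > 0\<close> m
    by (intro continuous_map_pairedI) (simp_all add: comp_def)
  have p_top: "?p t \<in> topspace (prod_topology E1 E2)" if "t \<in> {0..k}" for t
    using funcset_mem[OF continuous_map_funspace[OF p], of t] that by simp
  have "dist (\<pi> ((g \<circ> ?p) s)) (\<pi> ((g \<circ> ?p) t)) \<le> \<bar>s - t\<bar>" if st: "s \<in> {0..k}" "t \<in> {0..k}" for s t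
  proof -
    have sc: "\<bar>r * (s / k) - r * (t / k)\<bar> = r * (\<bar>s - t\<bar> / k)" if "0 \<le> r" for r
    proof -
      have "r * (s / k) - r * (t / k) = r * ((s - t) / k)" by (simp add: right_diff_distrib diff_divide_distrib)
      then show ?thesis using that k by (simp add: abs_mult abs_divide)
    qed
    have "dist (\<pi> (g (?p s))) (\<pi> (g (?p t))) = dist (\<pi>1 (c (l * (s / k))), \<pi>2 (d (m * (s / k)))) (\<pi>1 (c (l * (t / k))), \<pi>2 (d (m * (t / k))))"
      using proj[OF p_top[OF st(1)]] proj[OF p_top[OF st(2)]] by simp
    also have "\<dots> \<le> k * (\<bar>s - t\<bar> / k)"
    proof (rule dist_Pair_scale[of _ _ l _ _ _ m, folded k_def])
      show "dist (\<pi>1 (c (l * (s / k)))) (\<pi>1 (c (l * (t / k)))) \<le> l * (\<bar>s - t\<bar> / k)"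
        using c(4)[OF scale[OF _ st(1)] scale[OF _ st(2)]] sc[of l] \<open>l > 0\<close> by simp
      show "dist (\<pi>2 (d (m * (s / k)))) (\<pi>2 (d (m * (t / k)))) \<le> m * (\<bar>s - t\<bar> / k)"
        using d(4)[OF scale[OF _ st(1)] scale[OF _ st(2)]] sc[of m] m by simp
    qed (use k in simp)
    also have "\<dots> = \<bar>s - t\<bar>" using k by simp
    finally show ?thesis by simp
  qed
  moreover have "continuous_map (top_of_set {0..k}) E (g \<circ> ?p)" using p g by (rule continuous_map_compose)
  moreover have "(g \<circ> ?p) 0 = g (x, y)" "(g \<circ> ?p) k = g (x', y')"
    using k c(2,3) d(2,3) by simp_all
  ultimately show ?thesis
    unfolding reach_def k_def[symmetric] using k by (intro conjI exI[of _ "g \<circ> ?p"]) auto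
qed

text \<open>The bound from above pairs nearly shortest curves of the factors by \<open>reach_prod\<close>. For the bound
  from below, a curve in the product of length less than \<open>l\<close> has inscribed polygons of length less
  than \<open>l\<close>; both projections of a fine polygon lift with the right ends by \<open>reach_polygon\<close>, and
  \<open>sqrt_sum_squares_sum_le\<close> compares the lengths. Since the same subdivision is used in both factors, no
  common refinement has to be formed.\<close>

lemma lifted_dist_prod:
  fixes \<pi>1 :: "'e \<Rightarrow> 'a::metric_space" and \<pi>2 :: "'f \<Rightarrow> 'b::metric_space" and \<pi> :: "'g \<Rightarrow> 'a \<times> 'b"
  assumes geo: "lipschitz_geodesics TYPE('a)" "lipschitz_geodesics TYPE('b)"
    and sec: "sections_over_balls E1 \<pi>1 \<delta>" "sections_over_balls E2 \<pi>2 \<delta>" and "\<delta> > 0"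
    and conn: "path_connected_space E1" "path_connected_space E2"
    and iso: "cover_isomorphism E \<pi> (prod_topology E1 E2) (map_prod \<pi>1 \<pi>2) f"
    and e: "e \<in> topspace E" "e' \<in> topspace E"
  shows "lifted_dist E \<pi> e e' = prod_dist (lifted_dist E1 \<pi>1) (lifted_dist E2 \<pi>2) (f e) (f e')"
proof -
  let ?P = "prod_topology E1 E2"
  obtain g where "homeomorphic_maps E ?P f g"
    using iso unfolding cover_isomorphism_def homeomorphic_map_maps by blast
  then have f: "continuous_map E ?P f" and g: "continuous_map ?P E g"
    and gf: "\<And>x. x \<in> topspace E \<Longrightarrow> g (f x) = x" and fg: "\<And>y. y \<in> topspace ?P \<Longrightarrow> f (g y) = y"
    unfolding homeomorphic_maps_def by blast+
  have pf: "map_prod \<pi>1 \<pi>2 (f x) = \<pi> x" if "x \<in> topspace E" for x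
    using iso that unfolding cover_isomorphism_def by blast
  have pg: "\<pi> (g y) = (\<pi>1 (fst y), \<pi>2 (snd y))" if "y \<in> topspace ?P" for y
    using pf[of "g y"] fg[OF that] funcset_mem[OF continuous_map_funspace[OF g] that]
    by (simp add: map_prod_def split_beta)
  obtain x y x' y' where xy: "f e = (x, y)" "f e' = (x', y')" by (metis prod.collapse)
  have top: "x \<in> topspace E1" "y \<in> topspace E2" "x' \<in> topspace E1" "y' \<in> topspace E2"
    using funcset_mem[OF continuous_map_funspace[OF f] e(1)]
      funcset_mem[OF continuous_map_funspace[OF f] e(2)] xy by simp_all
  obtain m1 where m1: "reach E1 \<pi>1 m1 x x'"
    using path_connected_imp_reach[OF geo(1) sec(1) \<open>\<delta> > 0\<close> conn(1) top(1,3)] by blast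
  obtain m2 where m2: "reach E2 \<pi>2 m2 y y'"
    using path_connected_imp_reach[OF geo(2) sec(2) \<open>\<delta> > 0\<close> conn(2) top(2,4)] by blast
  let ?L1 = "lifted_dist E1 \<pi>1 x x'" and ?L2 = "lifted_dist E2 \<pi>2 y y'" and ?L = "lifted_dist E \<pi> e e'"
  have reachE: "reach E \<pi> (sqrt (l\<^sup>2 + m\<^sup>2)) e e'" if "?L1 < l" "?L2 < m" for l m
  proof -
    have "l > 0" by (rule le_less_trans[OF lifted_dist_nonneg that(1)])
    have r: "reach E1 \<pi>1 l x x'" "reach E2 \<pi>2 m y y'"
      by (rule lifted_dist_less_imp_reach[OF geo(1) sec(1) \<open>\<delta> > 0\<close> m1 that(1)],
        rule lifted_dist_less_imp_reach[OF geo(2) sec(2) \<open>\<delta> > 0\<close> m2 that(2)])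
    have "reach E \<pi> (sqrt (l\<^sup>2 + m\<^sup>2)) (g (x, y)) (g (x', y'))"
      by (rule reach_prod[OF g pg r \<open>l > 0\<close>])
    then show ?thesis
      using gf[OF e(1)] gf[OF e(2)] xy by simp
  qed
  have "?L \<le> sqrt (?L1\<^sup>2 + ?L2\<^sup>2)"
  proof (rule field_le_epsilon)
    fix \<epsilon> :: real assume "\<epsilon> > 0"
    then have "?L \<le> sqrt ((?L1 + \<epsilon> / 2)\<^sup>2 + (?L2 + \<epsilon> / 2)\<^sup>2)"
      by (intro lifted_dist_le_reach(2) reachE) simp_all
    also have "\<dots> \<le> sqrt (?L1\<^sup>2 + ?L2\<^sup>2) + sqrt ((\<epsilon> / 2)\<^sup>2 + (\<epsilon> / 2)\<^sup>2)"
      by (rule real_sqrt_sum_squares_triangle_ineq)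
    also have "sqrt ((\<epsilon> / 2)\<^sup>2 + (\<epsilon> / 2)\<^sup>2) \<le> \<epsilon>"
      using sqrt_sum_squares_le_sum[of "\<epsilon> / 2" "\<epsilon> / 2"] \<open>\<epsilon> > 0\<close> by simp
    finally show "?L \<le> sqrt (?L1\<^sup>2 + ?L2\<^sup>2) + \<epsilon>" by simp
  qed
  moreover have "sqrt (?L1\<^sup>2 + ?L2\<^sup>2) \<le> ?L"
  proof (rule dense_ge)
    fix l assume l: "?L < l"
    have "reach E \<pi> (sqrt ((?L1 + 1)\<^sup>2 + (?L2 + 1)\<^sup>2)) e e'" by (rule reachE) simp_all
    from lifted_dist_less_imp_path[OF this l] obtain c where c: "pathin E c" "c 0 = e" "c 1 = e'" "curve_length (\<pi> \<circ> c) < ennreal l"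
      by blast
    let ?c1 = "fst \<circ> (f \<circ> c)" and ?c2 = "snd \<circ> (f \<circ> c)"
    have fc: "pathin ?P (f \<circ> c)" using c(1) f by (rule pathin_compose)
    have c12: "pathin E1 ?c1" "pathin E2 ?c2"
      using pathin_compose[OF fc continuous_map_fst] pathin_compose[OF fc continuous_map_snd] by simp_all
    have split: "\<pi> (c t) = (\<pi>1 (?c1 t), \<pi>2 (?c2 t))" if "t \<in> {0..1}" for t
      using pf[of "c t"] funcset_mem[OF path_image_subset_topspace[OF c(1)] that]
      by (simp add: map_prod_def split_beta)
    obtain N1 where N1: "N1 > 0" "\<And>n. n \<ge> N1 \<Longrightarrow> reach E1 \<pi>1
      (\<Sum>i<n. dist (\<pi>1 (?c1 (real i / real n))) (\<pi>1 (?c1 (real (Suc i) / real n)))) (?c1 0) (?c1 1)"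
      using reach_polygon[OF geo(1) sec(1) \<open>\<delta> > 0\<close> c12(1)] by blast
    obtain N2 where N2: "N2 > 0" "\<And>n. n \<ge> N2 \<Longrightarrow> reach E2 \<pi>2
      (\<Sum>i<n. dist (\<pi>2 (?c2 (real i / real n))) (\<pi>2 (?c2 (real (Suc i) / real n)))) (?c2 0) (?c2 1)"
      using reach_polygon[OF geo(2) sec(2) \<open>\<delta> > 0\<close> c12(2)] by blast
    \<comment> \<open>One subdivision that is fine enough for both projections.\<close>
    define n where "n = max N1 N2"
    have n: "n > 0" "n \<ge> N1" "n \<ge> N2" using N1(1) by (auto simp: n_def)
    define a where "a i = dist (\<pi>1 (?c1 (real i / real n))) (\<pi>1 (?c1 (real (Suc i) / real n)))" for i
    define b where "b i = dist (\<pi>2 (?c2 (real i / real n))) (\<pi>2 (?c2 (real (Suc i) / real n)))" for i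
    have "?L1 \<le> (\<Sum>i<n. a i)" "?L2 \<le> (\<Sum>i<n. b i)"
      using lifted_dist_le_reach(2)[OF N1(2)[OF n(2)]] lifted_dist_le_reach(2)[OF N2(2)[OF n(3)]] c(2,3) xy
      by (simp_all add: a_def b_def)
    then have "sqrt (?L1\<^sup>2 + ?L2\<^sup>2) \<le> sqrt ((\<Sum>i<n. a i)\<^sup>2 + (\<Sum>i<n. b i)\<^sup>2)"
      by (intro real_sqrt_le_mono add_mono power_mono lifted_dist_nonneg)
    also have "\<dots> \<le> (\<Sum>i<n. sqrt ((a i)\<^sup>2 + (b i)\<^sup>2))" by (rule sqrt_sum_squares_sum_le)
    also have "\<dots> = (\<Sum>i<n. dist (\<pi> (c (real i / real n))) (\<pi> (c (real (Suc i) / real n))))"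
    proof (rule sum.cong[OF refl])
      fix i assume "i \<in> {..<n}"
      then have "real i / real n \<in> {0..1}" "real (Suc i) / real n \<in> {0..1}"
        by (auto simp: divide_le_eq)
      then show "sqrt ((a i)\<^sup>2 + (b i)\<^sup>2) = dist (\<pi> (c (real i / real n))) (\<pi> (c (real (Suc i) / real n)))"
        by (simp only: split dist_Pair_Pair a_def b_def)
    qed
    also have "\<dots> < l" using polygon_le_curve_length[OF n(1) c(4)] by simp
    finally show "sqrt (?L1\<^sup>2 + ?L2\<^sup>2) \<le> l" by simp
  qed
  ultimately show ?thesis by (simp add: prod_dist_def xy)
qed

section \<open>The delta-cover of a product\<close>

lemma path_connected_delta_cover: "path_connected_space (delta_cover p \<delta>)"
  unfolding delta_cover_def by (rule path_connected_cover_space)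

lemma delta_dist_prod:
  fixes p :: "'a::metric_space" and q :: "'b::metric_space"
  assumes geo: "lipschitz_geodesics TYPE('a)" "lipschitz_geodesics TYPE('b)" and "\<delta> > 0"
    and e: "e \<in> topspace (delta_cover (p, q) \<delta>)" "e' \<in> topspace (delta_cover (p, q) \<delta>)"
  shows "prod_dist (delta_dist p \<delta>) (delta_dist q \<delta>) (delta_cover_split p q \<delta> e) (delta_cover_split p q \<delta> e') =
    delta_dist (p, q) \<delta> e e'"
  unfolding delta_dist_def
  by (rule lifted_dist_prod[symmetric, OF geo
      sections_over_balls_delta_cover[OF geo(1) \<open>\<delta> > 0\<close>] sections_over_balls_delta_cover[OF geo(2) \<open>\<delta> > 0\<close>]
      \<open>\<delta> > 0\<close> path_connected_delta_cover path_connected_delta_cover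
      cover_isomorphism_delta_cover_split e])

section \<open>Covering spectrum\<close>

lemma cover_isomorphism_sym:
  assumes "cover_isomorphism E \<pi> E' \<pi>' f"
  obtains g where "cover_isomorphism E' \<pi>' E \<pi> g"
proof -
  obtain g where g: "homeomorphic_maps E E' f g"
    using assms unfolding cover_isomorphism_def homeomorphic_map_maps by blast
  then have cont: "continuous_map E' E g" unfolding homeomorphic_maps_def by blast
  have "\<pi> (g y) = \<pi>' y" if "y \<in> topspace E'" for y
  proof -
    have "g y \<in> topspace E" by (rule funcset_mem[OF continuous_map_funspace[OF cont] that])
    then have "\<pi>' (f (g y)) = \<pi> (g y)" using assms unfolding cover_isomorphism_def by blast
    then show ?thesis using g that unfolding homeomorphic_maps_def by simp
  qed
  moreover have "homeomorphic_map E' E g"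
    using g homeomorphic_maps_imp_map by (subst (asm) homeomorphic_maps_sym)
  ultimately show thesis by (intro that[of g]) (simp add: cover_isomorphism_def)
qed

text \<open>A loop \<open>\<gamma>\<close> that lifts to a closed path in the first cover does so, via the isomorphism, at some point
  above \<open>p\<close> in the second. This point is the class of a loop \<open>\<sigma>\<close>, by unique lifting the lift there ends at the
  class of \<open>\<sigma> +++ \<gamma>\<close>, and so a conjugate of \<open>\<gamma>\<close> is null. Normality removes the conjugation, so that
  isomorphisms which do not preserve base points cause no difficulty.\<close>

lemma null_loop_if_cover_isomorphism:
  fixes p :: "'a::metric_space"
  assumes geo: "lipschitz_geodesics TYPE('a)" and "\<delta> > 0"
    and iso: "cover_isomorphism (cover_space \<U> p) cover_proj (delta_cover p \<delta>) cover_proj f"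
    and null: "null_loop \<U> p \<gamma>"
  shows "null_loop (balls \<delta>) p \<gamma>"
proof -
  have g: "loop_at p \<gamma>" using null by (rule null_loop_imp_loop)
  have f: "continuous_map (cover_space \<U> p) (delta_cover p \<delta>) f"
    using iso homeomorphic_imp_continuous_map unfolding cover_isomorphism_def by blast
  have pf: "cover_proj (f e) = cover_proj e" if "e \<in> topspace (cover_space \<U> p)" for e
    using iso that unfolding cover_isomorphism_def by blast
  let ?b = "\<lambda>_::real. p"
  have b: "path_from p ?b" by simp
  let ?c = "\<lambda>t. cover_point \<U> p (?b +++ (\<gamma> \<circ> linepath 0 t))"
  have c: "pathin (cover_space \<U> p) ?c" using g by (intro pathin_lift) simp_all
  have c_top: "?c t \<in> topspace (cover_space \<U> p)" if "t \<in> {0..1}" for t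
    using funcset_mem[OF path_image_subset_topspace[OF c] that] .
  have c0: "?c 0 = cover_point \<U> p ?b" using g by (intro lift_start) simp_all
  have "?c 1 = cover_point \<U> p \<gamma>"
    unfolding lift_finish using g by (intro cover_point_homotopic homotopic_paths_const_left) simp_all
  also have "\<dots> = cover_point \<U> p ?b"
  proof -
    have "homotopic_paths UNIV (\<gamma> +++ reversepath ?b) \<gamma>"
      using g homotopic_paths_const_right[of \<gamma> p] by (simp add: reversepath_def)
    then show ?thesis
      using g null null_loop_homotopic by (subst cover_point_eq_iff) auto
  qed
  finally have closed: "?c 1 = ?c 0" using c0 by simp
  have proj_c: "cover_proj (?c t) = \<gamma> t" if "t \<in> {0..1}" for t
    using g that by (intro cover_proj_lift) simp_all
  have fc0: "f (?c 0) \<in> topspace (delta_cover p \<delta>)"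
    using funcset_mem[OF continuous_map_funspace[OF f] c_top[of 0]] by simp
  then obtain \<sigma> where s: "path_from p \<sigma>" "f (?c 0) = cover_point (balls \<delta>) p \<sigma>"
    unfolding topspace_delta_cover by blast
  have fin: "pathfinish \<sigma> = p"
    using cover_proj_cover_point[OF s(1), of "balls \<delta>"] pf[OF c_top[of 0]] proj_c[of 0] g s(2)
    by (simp add: pathstart_def)
  let ?d = "\<lambda>t. cover_point (balls \<delta>) p (\<sigma> +++ (\<gamma> \<circ> linepath 0 t))"
  have fc1: "(f \<circ> ?c) 1 = ?d 1"
  proof (rule unique_lifting[OF sections_over_balls_delta_cover[OF geo \<open>\<delta> > 0\<close>] \<open>\<delta> > 0\<close>])
    show "pathin (delta_cover p \<delta>) (f \<circ> ?c)" by (rule pathin_compose[OF c f])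
    show "pathin (delta_cover p \<delta>) ?d"
      unfolding delta_cover_def using g s fin by (intro pathin_lift) simp_all
    have "?d 0 = cover_point (balls \<delta>) p \<sigma>" using g s fin by (intro lift_start) simp_all
    then show "(f \<circ> ?c) 0 = ?d 0" using s(2) by simp
    fix t :: real assume t: "t \<in> {0..1}"
    have "cover_proj (?d t) = \<gamma> t" using g s fin t by (intro cover_proj_lift) simp_all
    then show "cover_proj ((f \<circ> ?c) t) = cover_proj (?d t)"
      using pf[OF c_top[OF t]] proj_c[OF t] by simp
  qed simp
  have "cover_point (balls \<delta>) p (\<sigma> +++ \<gamma>) = ?d 1" by (rule lift_finish[symmetric])
  also have "\<dots> = f (?c 1)" using fc1[unfolded comp_apply[of f ?c 1]] by (rule sym)
  also have "\<dots> = f (?c 0)" by (rule arg_cong[OF closed])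
  also have "\<dots> = cover_point (balls \<delta>) p \<sigma>" by (rule s(2))
  finally have "cover_point (balls \<delta>) p (\<sigma> +++ \<gamma>) = cover_point (balls \<delta>) p \<sigma>" .
  then have conj: "null_loop (balls \<delta>) p ((\<sigma> +++ \<gamma>) +++ reversepath \<sigma>)"
    using cover_point_eq_iff[of "\<sigma> +++ \<gamma>" p \<sigma>] g s(1) fin by simp
  have "null_loop (balls \<delta>) p ((reversepath \<sigma> +++ ((\<sigma> +++ \<gamma>) +++ reversepath \<sigma>)) +++ reversepath (reversepath \<sigma>))"
    using s(1) fin by (intro null_loop_conjugate[OF conj]) simp
  moreover have "homotopic_paths UNIV \<gamma>
      ((reversepath \<sigma> +++ ((\<sigma> +++ \<gamma>) +++ reversepath \<sigma>)) +++ reversepath (reversepath \<sigma>))"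
  proof (rule homotopic_paths_sym)
    have inv: "homotopic_paths UNIV (reversepath \<sigma> +++ \<sigma>) ?b"
      using homotopic_paths_inverse_right[of "reversepath \<sigma>"] s(1) fin by simp
    have "homotopic_paths UNIV ((reversepath \<sigma> +++ ((\<sigma> +++ \<gamma>) +++ reversepath \<sigma>)) +++ \<sigma>)
       (((reversepath \<sigma> +++ (\<sigma> +++ \<gamma>)) +++ reversepath \<sigma>) +++ \<sigma>)"
      using g s(1) fin by (intro homotopic_paths_join homotopic_paths_assoc_UNIV) simp_all
    also have "homotopic_paths UNIV \<dots> ((reversepath \<sigma> +++ (\<sigma> +++ \<gamma>)) +++ (reversepath \<sigma> +++ \<sigma>))"
      using g s(1) fin by (intro homotopic_paths_sym[OF homotopic_paths_assoc_UNIV]) simp_all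
    also have "homotopic_paths UNIV \<dots> (((reversepath \<sigma> +++ \<sigma>) +++ \<gamma>) +++ ?b)"
      using g s(1) fin inv by (intro homotopic_paths_join homotopic_paths_assoc_UNIV) simp_all
    also have "homotopic_paths UNIV \<dots> ((reversepath \<sigma> +++ \<sigma>) +++ \<gamma>)"
      using g s(1) fin by (intro homotopic_paths_const_right) simp_all
    also have "homotopic_paths UNIV \<dots> (?b +++ \<gamma>)"
      using g s(1) fin inv by (intro homotopic_paths_join) simp_all
    also have "homotopic_paths UNIV \<dots> \<gamma>"
      using g by (intro homotopic_paths_const_left) simp_all
    finally show "homotopic_paths UNIV
      ((reversepath \<sigma> +++ ((\<sigma> +++ \<gamma>) +++ reversepath \<sigma>)) +++ reversepath (reversepath \<sigma>)) \<gamma>"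
      by simp
  qed
  ultimately show ?thesis using null_loop_homotopic by blast
qed

lemma null_loop_balls_mono:
  assumes "\<delta> \<le> \<delta>'" "null_loop (balls \<delta>) p \<gamma>"
  shows "null_loop (balls \<delta>') p \<gamma>"
proof -
  have ref: "\<exists>V\<in>balls \<delta>'. (\<lambda>x. x) ` U \<subseteq> V" if U: "U \<in> balls \<delta>" for U :: "'a set"
  proof -
    obtain y where "U = ball y \<delta>" using U by blast
    then have "(\<lambda>x. x) ` U \<subseteq> ball y \<delta>'" using subset_ball[OF assms(1)] by simp
    then show ?thesis by blast
  qed
  have "null_loop (balls \<delta>') p ((\<lambda>x. x) \<circ> \<gamma>)"
    by (rule null_loop_image[OF continuous_on_id ref assms(2)])
  then show ?thesis by (simp add: comp_def)
qed

text \<open>The covers are isomorphic iff their subgroups coincide; one inclusion always holds as the covering by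
  larger balls is coarser.\<close>

lemma delta_covers_isomorphic_iff:
  fixes p :: "'a::metric_space"
  assumes geo: "lipschitz_geodesics TYPE('a)" and "0 < \<delta>" "\<delta> \<le> \<delta>'"
  shows "(\<exists>f. cover_isomorphism (delta_cover p \<delta>) cover_proj (delta_cover p \<delta>') cover_proj f) \<longleftrightarrow>
    (\<forall>\<gamma>. null_loop (balls \<delta>') p \<gamma> \<longrightarrow> null_loop (balls \<delta>) p \<gamma>)"
proof
  assume "\<exists>f. cover_isomorphism (delta_cover p \<delta>) cover_proj (delta_cover p \<delta>') cover_proj f"
  then obtain f where "cover_isomorphism (delta_cover p \<delta>) cover_proj (delta_cover p \<delta>') cover_proj f" ..
  then obtain g where "cover_isomorphism (delta_cover p \<delta>') cover_proj (delta_cover p \<delta>) cover_proj g"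
    by (rule cover_isomorphism_sym)
  then show "\<forall>\<gamma>. null_loop (balls \<delta>') p \<gamma> \<longrightarrow> null_loop (balls \<delta>) p \<gamma>"
    unfolding delta_cover_def[of p \<delta>']
    by (intro allI impI) (rule null_loop_if_cover_isomorphism[OF geo \<open>0 < \<delta>\<close>])
next
  assume "\<forall>\<gamma>. null_loop (balls \<delta>') p \<gamma> \<longrightarrow> null_loop (balls \<delta>) p \<gamma>"
  then have "null_loop (balls \<delta>') p \<gamma> \<longleftrightarrow> null_loop (balls \<delta>) p \<gamma>" for \<gamma>
    using null_loop_balls_mono[OF assms(3)] by blast
  then have "cover_point (balls \<delta>') p = cover_point (balls \<delta>) p"
    unfolding cover_point_def null_loop_def by (intro ext) simp
  then have "delta_cover p \<delta>' = delta_cover p \<delta>"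
    unfolding delta_cover_def cover_space_def by simp
  then show "\<exists>f. cover_isomorphism (delta_cover p \<delta>) cover_proj (delta_cover p \<delta>') cover_proj f"
    unfolding cover_isomorphism_def by (intro exI[of _ id]) simp
qed

lemma covering_spectrum_iff:
  assumes "lipschitz_geodesics TYPE('a::metric_space)"
  shows "\<delta> \<in> covering_spectrum TYPE('a) \<longleftrightarrow> \<delta> > 0 \<and>
    (\<forall>\<delta>'>\<delta>. \<forall>p::'a. \<exists>\<gamma>. null_loop (balls \<delta>') p \<gamma> \<and> \<not> null_loop (balls \<delta>) p \<gamma>)"
  unfolding covering_spectrum_def mem_Collect_eq
  by (rule conj_cong[OF refl]) (simp add: delta_covers_isomorphic_iff[OF assms])

text \<open>A loop that distinguishes two scales in a factor does so in the product, in any slice. Conversely, if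
  a scale is in neither spectrum, then passing to \<open>\<delta>1\<close> at \<open>p\<close> and to \<open>\<delta>2\<close> at \<open>q\<close> creates no new null loops in
  the factors, and by \<open>null_loop_prod\<close> and monotonicity passing to the minimum of both creates none in the product.\<close>

lemma covering_spectrum_prod:
  assumes geo: "lipschitz_geodesics TYPE('a::metric_space)" "lipschitz_geodesics TYPE('b::metric_space)"
  shows "covering_spectrum TYPE('a \<times> 'b) = covering_spectrum TYPE('a) \<union> covering_spectrum TYPE('b)"
proof (intro Set.set_eqI)
  fix \<delta> :: real
  note spec = covering_spectrum_iff[OF geo(1)] covering_spectrum_iff[OF geo(2)]
    covering_spectrum_iff[OF lipschitz_geodesics_prod[OF geo]]
  show "\<delta> \<in> covering_spectrum TYPE('a \<times> 'b) \<longleftrightarrow>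
    \<delta> \<in> covering_spectrum TYPE('a) \<union> covering_spectrum TYPE('b)"
  proof
    assume "\<delta> \<in> covering_spectrum TYPE('a) \<union> covering_spectrum TYPE('b)"
    then show "\<delta> \<in> covering_spectrum TYPE('a \<times> 'b)"
    proof
      assume a: "\<delta> \<in> covering_spectrum TYPE('a)"
      have "\<exists>\<gamma>. null_loop (balls \<delta>') x \<gamma> \<and> \<not> null_loop (balls \<delta>) x \<gamma>" if d: "\<delta>' > \<delta>" for \<delta>' and x :: "'a \<times> 'b"
      proof -
        obtain \<gamma> where "null_loop (balls \<delta>') (fst x) \<gamma>" "\<not> null_loop (balls \<delta>) (fst x) \<gamma>"
          using a d unfolding spec by blast
        then show ?thesis
          using null_loop_Pair_left[of \<delta>' "fst x" \<gamma> "snd x"]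
            null_loop_fst[of \<delta> x "\<lambda>t. (\<gamma> t, snd x)"] by (auto simp: comp_def)
      qed
      then show ?thesis using a unfolding spec by blast
    next
      assume b: "\<delta> \<in> covering_spectrum TYPE('b)"
      have "\<exists>\<gamma>. null_loop (balls \<delta>') x \<gamma> \<and> \<not> null_loop (balls \<delta>) x \<gamma>" if d: "\<delta>' > \<delta>" for \<delta>' and x :: "'a \<times> 'b"
      proof -
        obtain \<gamma> where "null_loop (balls \<delta>') (snd x) \<gamma>" "\<not> null_loop (balls \<delta>) (snd x) \<gamma>"
          using b d unfolding spec by blast
        then show ?thesis
          using null_loop_Pair_right[of \<delta>' "snd x" \<gamma> "fst x"]
            null_loop_snd[of \<delta> x "\<lambda>t. (fst x, \<gamma> t)"] by (auto simp: comp_def)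
      qed
      then show ?thesis using b unfolding spec by blast
    qed
  next
    assume c: "\<delta> \<in> covering_spectrum TYPE('a \<times> 'b)"
    show "\<delta> \<in> covering_spectrum TYPE('a) \<union> covering_spectrum TYPE('b)"
    proof (rule ccontr)
      assume neg: "\<delta> \<notin> covering_spectrum TYPE('a) \<union> covering_spectrum TYPE('b)"
      have "\<delta> > 0" using c unfolding spec by blast
      obtain \<delta>1 and p :: 'a where d1: "\<delta>1 > \<delta>"
        "\<And>\<gamma>. null_loop (balls \<delta>1) p \<gamma> \<Longrightarrow> null_loop (balls \<delta>) p \<gamma>"
        using neg \<open>\<delta> > 0\<close> unfolding Un_iff spec by blast
      obtain \<delta>2 and q :: 'b where d2: "\<delta>2 > \<delta>"
        "\<And>\<gamma>. null_loop (balls \<delta>2) q \<gamma> \<Longrightarrow> null_loop (balls \<delta>) q \<gamma>"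
        using neg \<open>\<delta> > 0\<close> unfolding Un_iff spec by blast
      note d = d1(1) d2(1) d1(2) d2(2)
      have "min \<delta>1 \<delta>2 > \<delta>" using d by simp
      then obtain \<gamma> where g: "null_loop (balls (min \<delta>1 \<delta>2)) (p, q) \<gamma>" "\<not> null_loop (balls \<delta>) (p, q) \<gamma>"
        using c unfolding spec by blast
      have "null_loop (balls \<delta>1) p (fst \<circ> \<gamma>)" "null_loop (balls \<delta>2) q (snd \<circ> \<gamma>)"
        using g(1) unfolding null_loop_prod by (auto intro: null_loop_balls_mono[rotated])
      then have "null_loop (balls \<delta>) (p, q) \<gamma>" unfolding null_loop_prod using d by blast
      then show False using g(2) by blast
    qed
  qed
qed

theorem theorem4p3:
  assumes "geodesic_space TYPE('a::metric_space)"
    and "geodesic_space TYPE('b::metric_space)"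
  shows "(\<forall>\<delta>>0. \<forall>(p1::'a) (p2::'b). \<exists>f.
            cover_isomorphism
              (delta_cover (p1, p2) \<delta>) cover_proj
              (prod_topology (delta_cover p1 \<delta>) (delta_cover p2 \<delta>)) (map_prod cover_proj cover_proj) f \<and>
            (\<forall>e \<in> topspace (delta_cover (p1, p2) \<delta>). \<forall>e' \<in> topspace (delta_cover (p1, p2) \<delta>).
               prod_dist (delta_dist p1 \<delta>) (delta_dist p2 \<delta>) (f e) (f e') =
               delta_dist (p1, p2) \<delta> e e')) \<and>
         covering_spectrum TYPE('a \<times> 'b) =
         covering_spectrum TYPE('a) \<union> covering_spectrum TYPE('b)"
proof -
  note geo = assms[THEN geodesic_space_imp_lipschitz_geodesics]
  show ?thesis
  proof (intro conjI allI impI covering_spectrum_prod[OF geo])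
    fix \<delta> :: real and p1 :: 'a and p2 :: 'b
    assume "\<delta> > 0"
    then show "\<exists>f. cover_isomorphism (delta_cover (p1, p2) \<delta>) cover_proj
        (prod_topology (delta_cover p1 \<delta>) (delta_cover p2 \<delta>)) (map_prod cover_proj cover_proj) f \<and>
        (\<forall>e \<in> topspace (delta_cover (p1, p2) \<delta>). \<forall>e' \<in> topspace (delta_cover (p1, p2) \<delta>).
           prod_dist (delta_dist p1 \<delta>) (delta_dist p2 \<delta>) (f e) (f e') = delta_dist (p1, p2) \<delta> e e')"
      by (intro exI[of _ "delta_cover_split p1 p2 \<delta>"] conjI ballI
          cover_isomorphism_delta_cover_split delta_dist_prod[OF geo])
  qed
qed

end
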